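(* Fix an integer $k\ge2$ and let $f_k\ge\rho_k$ be a real number. Suppose that, for every $0<x\le1/f_k$, all independent, identically distributed random variables $Z_1,\ldots,Z_k$ with values in $[0,1]$ and $\mathbb E Z_i\le x$ satisfy $$\mathbb P(Z_1+\cdots+Z_k\ge1)\le q_k(x),$$ with equality if and only if their common law is $\mu_x=(1-x)\delta_0+x\delta_1$. Then there exists $s_0=s_0(k,f_k)$ such that the following holds. If $n,s$ are positive integers with $s\ge s_0$ and $n\ge f_k s$, and $\mathcal F\subseteq\binom{[n]}k$ satisfies $\nu(\mathcal F)\le s$, then $$|\mathcal F|\le M_k(n,s).$$ Equality holds if and only if $\mathcal F=\mathcal A(S)$ for some $S\in\binom{[n]}s$.
   Context: $\rho_k$ is the unique real number in $(k,k+1)$ satisfying $\rho_k^k-(\rho_k-1)^k=k^k$. $q_k(x):=1-(1-x)^k$, and $\delta_c$ is the unit point mass at $c$. $[n]=\{1,\dots,n\}$, and for a finite set $V$, $\binom Vk$ is the collection of all $k$-element subsets of $V$. A matching is a collection of pairwise disjoint members (edges) of a family; $\nu(\mathcal F)$ is the maximum size of a matching contained in $\mathcal F$. For $S\subseteq[n]$, $\mathcal A(S)=\{E\in\binom{[n]}k: E\cap S\ne\varnothing\}$. Also $M_k(n,s):=\binom nk-\binom{n-s}k$. *)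

theory Defs
  imports "HOL-Probability.Probability" "HOL-Library.Ramsey" "HOL-Library.Disjoint_Sets"
begin

definition rho :: "nat \<Rightarrow> real" where
  "rho k = (THE r. real k < r \<and> r < real k + 1 \<and> r ^ k - (r - 1) ^ k = real k ^ k)"

lemma rho_ex1:
  assumes k: "2 \<le> k"
  shows "\<exists>!r. real k < r \<and> r < real k + 1 \<and> r ^ k - (r - 1) ^ k = real k ^ k"
proof -
  define g where "g = (\<lambda>r::real. r ^ k - (r - 1) ^ k)"
  have mono: "g a < g b" if "1 \<le> a" "a < b" for a b
  proof (rule DERIV_pos_imp_increasing[OF \<open>a < b\<close>])
    fix x :: real assume "a \<le> x" "x \<le> b"
    then have "(x - 1) ^ (k - 1) < x ^ (k - 1)"
      using that k by (intro power_strict_mono) auto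
    moreover have "(g has_real_derivative real k * (x ^ (k - 1) - (x - 1) ^ (k - 1))) (at x)"
      unfolding g_def by (auto intro!: derivative_eq_intros simp: algebra_simps)
    ultimately show "\<exists>y. (g has_real_derivative y) (at x) \<and> 0 < y"
      using k by (intro exI conjI) auto
  qed
  have lo: "g (real k) < real k ^ k"
    using k by (simp add: g_def)
  have "2 * real k ^ k < (real k + 1) ^ k"
  proof -
    obtain j where j: "k = Suc (Suc j)"
      using k by (metis add_2_eq_Suc le_Suc_ex)
    have "1 + real (Suc j) * (1 / real k) \<le> (1 + 1 / real k) ^ Suc j"
      using Bernoulli_inequality[of "1 / real k" "Suc j"] by (simp add: order_trans[of "-1" 0])
    then have "(1 + 1 / real k) * (1 + real (Suc j) * (1 / real k)) \<le> (1 + 1 / real k) ^ k"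
      using j by (metis add_nonneg_nonneg mult_left_mono of_nat_0_le_iff power_Suc zero_le_divide_1_iff zero_le_one)
    moreover have "(1 + 1 / real k) * (1 + real (Suc j) * (1 / real k)) > 2"
    proof -
      have "2 * (real k * real k) < (real k + 1) * (2 * real k - 1)"
        using k by (simp add: algebra_simps)
      moreover have k1: "real (Suc j) = real k - 1"
        using j by simp
      moreover have "(1 + 1 / real k) * (1 + real (Suc j) * (1 / real k)) =
          (real k + 1) * (2 * real k - 1) / (real k * real k)"
        using k unfolding k1 by (simp add: field_simps)
      ultimately show ?thesis
        using k by (metis mult_pos_pos of_nat_0_less_iff order_less_le_trans pos2 pos_less_divide_eq)
    qed
    ultimately have "2 < (1 + 1 / real k) ^ k" by linarith
    moreover have "1 + 1 / real k = (real k + 1) / real k"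
      using k by (simp add: field_simps)
    ultimately show ?thesis
      using k by (simp add: power_divide field_simps)
  qed
  then have hi: "real k ^ k < g (real k + 1)"
    by (simp add: g_def)
  have "continuous_on {real k..real k + 1} g"
    unfolding g_def by (intro continuous_intros)
  then obtain r where r: "real k \<le> r" "r \<le> real k + 1" "g r = real k ^ k"
    using IVT'[of g "real k" "real k ^ k" "real k + 1"] lo hi by auto
  have "r \<noteq> real k" "r \<noteq> real k + 1" using r lo hi by auto
  with r have r': "real k < r" "r < real k + 1" by auto
  have "r = t" if "real k < t" "g t = real k ^ k" for t
    using mono[of r t] mono[of t r] that r r' k by (cases r t rule: linorder_cases) auto
  then have "\<exists>!r. real k < r \<and> r < real k + 1 \<and> g r = real k ^ k"
    using r r' by blast
  then show ?thesis
    by (simp only: g_def)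
qed

definition q_fun :: "nat \<Rightarrow> real \<Rightarrow> real" where
  "q_fun k x = 1 - (1 - x) ^ k"

text \<open>The law \<open>\<mu>\<^sub>x = (1 - x) \<delta>\<^sub>0 + x \<delta>\<^sub>1\<close>, for \<open>0 \<le> x \<le> 1\<close>; \<open>return borel c\<close> is \<open>\<delta>\<^sub>c\<close>.\<close>

definition two_point_law :: "real \<Rightarrow> real measure" where
  "two_point_law x = measure_of UNIV (sets borel)
     (\<lambda>A. ennreal (1 - x) * emeasure (return borel 0) A + ennreal x * emeasure (return borel 1) A)"

lemma sets_two_point_law [simp]: "sets (two_point_law x) = sets borel"
  unfolding two_point_law_def using sets.sigma_sets_eq[of "borel :: real measure"] by simp

lemma emeasure_two_point_law:
  assumes "A \<in> sets borel"
  shows "emeasure (two_point_law x) A =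
    ennreal (1 - x) * emeasure (return borel 0) A + ennreal x * emeasure (return borel 1) A"
proof (rule emeasure_measure_of[OF two_point_law_def])
  let ?m = "\<lambda>A. ennreal (1 - x) * emeasure (return borel (0::real)) A +
                 ennreal x * emeasure (return borel 1) A"
  show "positive (sets (two_point_law x)) ?m"
    by (simp add: positive_def)
  show "countably_additive (sets (two_point_law x)) ?m"
  proof (rule countably_additiveI)
    fix A :: "nat \<Rightarrow> real set"
    assume A: "range A \<subseteq> sets (two_point_law x)" "disjoint_family A"
    then have "range A \<subseteq> sets (return borel c)" for c :: real
      by simp
    with A have "(\<Sum>i. emeasure (return borel c) (A i)) = emeasure (return borel c) (\<Union> (range A))" for c
      by (intro suminf_emeasure)
    moreover have "(\<Sum>i. ?m (A i)) = ennreal (1 - x) * (\<Sum>i. emeasure (return borel 0) (A i)) +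
        ennreal x * (\<Sum>i. emeasure (return borel 1) (A i))"
      by (subst suminf_add[symmetric]) (auto simp: ennreal_suminf_cmult simp del: emeasure_return)
    ultimately show "(\<Sum>i. ?m (A i)) = ?m (\<Union> (range A))"
      by (simp only:)
  qed
qed (use assms in auto)

definition iid_unit_interval :: "'w measure \<Rightarrow> nat \<Rightarrow> real \<Rightarrow> (nat \<Rightarrow> 'w \<Rightarrow> real) \<Rightarrow> bool" where
  "iid_unit_interval M k x Z \<longleftrightarrow>
     prob_space M \<and>
     prob_space.indep_vars M (\<lambda>_. borel) Z {1..k} \<and>
     (\<forall>i\<in>{1..k}. \<forall>j\<in>{1..k}. distr M borel (Z i) = distr M borel (Z j)) \<and>
     (\<forall>i\<in>{1..k}. \<forall>\<omega>\<in>space M. Z i \<omega> \<in> {0..1}) \<and>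
     (\<forall>i\<in>{1..k}. prob_space.expectation M (Z i) \<le> x)"

text \<open>
  The tail bound with its equality case, at a given \<open>x\<close>. A HOL formula cannot quantify over
  types, so the underlying set is fixed to be a subset of \<open>nat \<Rightarrow> real\<close>. This loses no generality:
  every family \<open>Z 1, \<dots>, Z k\<close> has the same joint law as the coordinates of a probability space
  of this type, and all conditions depend on the joint law only.
\<close>

definition tail_bound :: "nat \<Rightarrow> real \<Rightarrow> bool" where
  "tail_bound k x \<longleftrightarrow>
     (\<forall>(M :: (nat \<Rightarrow> real) measure) Z. iid_unit_interval M k x Z \<longrightarrow>
        \<P>(\<omega> in M. (\<Sum>i=1..k. Z i \<omega>) \<ge> 1) \<le> q_fun k x \<and>
        (\<P>(\<omega> in M. (\<Sum>i=1..k. Z i \<omega>) \<ge> 1) = q_fun k x \<longleftrightarrow>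
           (\<forall>i\<in>{1..k}. distr M borel (Z i) = two_point_law x)))"

text \<open>For finite \<open>F\<close>; \<open>Max\<close> is unspecified on infinite sets.\<close>

definition matching_number :: "'a set set \<Rightarrow> nat" where
  "matching_number F = Max {card N |N. N \<subseteq> F \<and> disjoint N}"

definition hitting_family :: "nat \<Rightarrow> nat \<Rightarrow> nat set \<Rightarrow> nat set set" where
  "hitting_family k n S = {E \<in> nsets {1..n} k. E \<inter> S \<noteq> {}}"

definition hitting_number :: "nat \<Rightarrow> nat \<Rightarrow> nat \<Rightarrow> nat" where
  "hitting_number k n s = (n choose k) - ((n - s) choose k)"

end

theory Submission
  imports Defs "HOL-Combinatorics.Permutations"
begin

text \<open>
  The proof first bounds the fractional matching problem by the tail inequality and then removes
  the error terms by a stability argument.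

  Shifting preserves sizes and does not increase matching numbers, and an extremal family can be
  recovered from its shift (\<open>unshift_hits\<close>), so \<open>F\<close> may be assumed to be shifted. Cut \<open>{1..n}\<close> into a
  bounded number \<open>m\<close> of blocks and keep the patterns of blocks all of whose transversals are edges.
  In a shifted family, lowering every vertex of an edge by one block yields such a pattern, so few
  edges are lost; conversely a fractional matching of the patterns can be rounded to a matching of
  \<open>F\<close> with an error that depends on \<open>m\<close> and \<open>k\<close> only. By linear programming duality there are
  weights on the blocks, with mean about \<open>s / n\<close>, such that every pattern has total weight at least
  \<open>1\<close>. Hence the weight of a random block is a law whose \<open>k\<close>-fold sum reaches \<open>1\<close> with probability at
  least the edge density of \<open>F\<close>, up to a small error.

  The tail inequality alone now gives the asymptotic bound. Its equality case gives more: the laws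
  on the unit interval form a compact space, so a law that almost attains the bound is close to
  \<open>\<mu>\<^sub>x\<close> (\<open>tail_bound_stability\<close>). Thus, if \<open>F\<close> is at least as large as the extremal family, only about
  a proportion \<open>s / n\<close> of the blocks has weight at least \<open>1 / k\<close>. Every pattern contains such a block,
  so \<open>F\<close> has a cover of size close to \<open>s\<close> (\<open>almost_cover\<close>), and it contains almost all sets that meet
  this cover.

  Consequently all but few of \<open>s\<close> vertices are good: they form an edge with every \<open>(k - 1)\<close>-set taken
  from the first \<open>k (s + 1)\<close> vertices, which exist since \<open>n \<ge> f s\<close> with \<open>f \<ge> \<rho>\<^sub>k > k\<close>. Such vertices
  can be added to a matching greedily, up to \<open>s + 1\<close> edges in total, so deleting \<open>s - t\<close> of them
  leaves a family with matching number at most \<open>t\<close>, where \<open>t\<close> is tiny compared with \<open>n\<close>. In that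
  range the theorem has an elementary inductive proof (\<open>erdos_matching_sparse\<close>), which gives the exact
  bound together with uniqueness.
\<close>

section \<open>Matchings and hitting families\<close>

definition matching_at_most :: "nat \<Rightarrow> 'a set set \<Rightarrow> bool" where
  "matching_at_most t F \<longleftrightarrow> (\<forall>N. N \<subseteq> F \<longrightarrow> disjoint N \<longrightarrow> card N \<le> t)"

text \<open>The analogue of \<open>hitting_family\<close> on an arbitrary ground set, which is needed once vertices have
  been deleted.\<close>

definition hits :: "'a set \<Rightarrow> nat \<Rightarrow> 'a set \<Rightarrow> 'a set set" where
  "hits V k S = {E \<in> nsets V k. E \<inter> S \<noteq> {}}"

lemma matching_at_mostD: "matching_at_most t F \<Longrightarrow> N \<subseteq> F \<Longrightarrow> disjoint N \<Longrightarrow> card N \<le> t"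
  by (simp add: matching_at_most_def)

lemma matching_at_most_iff:
  assumes "finite F"
  shows "matching_number F \<le> t \<longleftrightarrow> matching_at_most t F"
proof -
  let ?A = "{card N |N. N \<subseteq> F \<and> disjoint N}"
  have "finite ?A"
    using assms by (intro finite_subset[of ?A "card ` Pow F"]) auto
  moreover have "?A \<noteq> {}" by (auto intro: exI[of _ "{}"])
  ultimately show ?thesis
    unfolding matching_number_def matching_at_most_def by (subst Max_le_iff) auto
qed

lemma nsetsD: "E \<in> nsets V k \<Longrightarrow> E \<subseteq> V \<and> finite E \<and> card E = k"
  by (simp add: nsets_def)

lemma finite_hits: "finite V \<Longrightarrow> finite (hits V k S)"
  by (simp add: hits_def finite_imp_finite_nsets)

lemma hits_split: "nsets V k = hits V k S \<union> nsets (V - S) k" "hits V k S \<inter> nsets (V - S) k = {}" if "k > 0"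
  using that by (auto simp: hits_def nsets_def)

lemma card_hits:
  assumes "finite V" "S \<subseteq> V" "k > 0"
  shows "card (hits V k S) + (card V - card S choose k) = card V choose k"
proof -
  have "card (nsets V k) = card (hits V k S) + card (nsets (V - S) k)"
    using assms by (subst hits_split(1)[of k V S])
      (use assms hits_split(2)[OF assms(3), of V S] in
        \<open>auto intro!: card_Un_disjoint finite_hits finite_imp_finite_nsets simp del: card_nsets\<close>)
  thus ?thesis using assms by (simp add: card_Diff_subset finite_subset)
qed

lemma card_Union_le_mult:
  assumes "finite N" "\<And>E. E \<in> N \<Longrightarrow> card E \<le> k"
  shows "card (\<Union>N) \<le> card N * k"
  using card_Union_le_sum_card[of N] sum_bounded_above[of N card k] assms by auto

lemma disjoint_insert_edge:
  assumes "disjoint N" "E \<inter> \<Union>N = {}"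
  shows "disjoint (insert E N)"
  using assms by (auto simp: disjoint_def pairwise_insert disjnt_def)

section \<open>Sparse case: the ground set is much larger than the matching number\<close>

text \<open>By Pascal's rule the difference of the two coefficients telescopes into \<open>u\<close> coefficients of lower
  index, each of them between the first and the last.\<close>

lemma binomial_diff_bounds:
  assumes "k > 0"
  shows "(m + u choose k) \<le> (m choose k) + u * (m + u choose (k - 1))"
    and "(m choose k) + u * (m choose (k - 1)) \<le> (m + u choose k)"
proof (induction u)
  case (Suc u)
  have k: "k = Suc (k - 1)" using assms by simp
  have rec: "(m + Suc u choose k) = (m + u choose (k - 1)) + (m + u choose k)"
    by (subst k, subst (2 3) k) simp
  have mono: "(m + u choose (k - 1)) \<le> (m + Suc u choose (k - 1))"
    and mono': "(m choose (k - 1)) \<le> (m + u choose (k - 1))"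
    by (intro binomial_right_mono; simp)+
  { case 1
    have "(m + Suc u choose k) \<le> (m + u choose (k - 1)) + ((m choose k) + u * (m + u choose (k - 1)))"
      unfolding rec using Suc.IH(1) by (rule add_left_mono)
    also have "\<dots> = (m choose k) + Suc u * (m + u choose (k - 1))" by simp
    also have "\<dots> \<le> (m choose k) + Suc u * (m + Suc u choose (k - 1))"
      using mono by (intro add_left_mono mult_left_mono) auto
    finally show ?case .
  next
    case 2
    have "(m choose k) + Suc u * (m choose (k - 1)) = (m choose (k - 1)) + ((m choose k) + u * (m choose (k - 1)))"
      by simp
    also have "\<dots> \<le> (m + u choose (k - 1)) + (m + u choose k)"
      using mono' Suc.IH(2) by (rule add_mono)
    finally show ?case unfolding rec .
  }
qed auto

lemma binomial_le_power: "n choose k \<le> n ^ k"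
  by (metis binomial_eq_0_iff binomial_le_pow le0 not_le_imp_less)

text \<open>An edge through \<open>v\<close> that meets \<open>X\<close> is fixed by one point of \<open>X\<close> and \<open>k - 2\<close> further points.\<close>

lemma card_edges_through_meeting:
  assumes "finite V" "X \<subseteq> V" "v \<in> V" "v \<notin> X" "2 \<le> k"
  shows "card {E \<in> nsets V k. v \<in> E \<and> E \<inter> X \<noteq> {}} \<le> card X * card V ^ (k - 2)"
proof -
  let ?A = "{E \<in> nsets V k. v \<in> E \<and> E \<inter> X \<noteq> {}}"
  have "finite X" using assms finite_subset by blast
  have "?A \<subseteq> (\<lambda>(x, D). insert v (insert x D)) ` (X \<times> nsets V (k - 2))"
  proof
    fix E assume "E \<in> ?A"
    then obtain x where E: "E \<in> nsets V k" "v \<in> E" "x \<in> E" "x \<in> X" by auto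
    then have "v \<noteq> x" using assms by auto
    then have "card (E - {v, x}) = k - 2"
      using E by (subst card_Diff_subset) (auto simp: nsets_def)
    then have "E - {v, x} \<in> nsets V (k - 2)" and "E = insert v (insert x (E - {v, x}))"
      using E by (auto simp: nsets_def)
    thus "E \<in> (\<lambda>(x, D). insert v (insert x D)) ` (X \<times> nsets V (k - 2))"
      using E(4) by (intro image_eqI[of _ _ "(x, E - {v, x})"]) auto
  qed
  then have "card ?A \<le> card (X \<times> nsets V (k - 2))"
    using \<open>finite X\<close> assms(1) by (intro surj_card_le) (auto simp: finite_imp_finite_nsets)
  also have "\<dots> \<le> card X * card V ^ (k - 2)"
    by (simp add: card_cartesian_product binomial_le_power)
  finally show ?thesis .
qed

text \<open>The first summand makes the crude count below too small; the second one leaves room for the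
  bound \<open>n - u \<ge> n / 2\<close> and for \<open>k - 1\<close> vertices outside \<open>u\<close> given ones.\<close>

definition sparse_const :: "nat \<Rightarrow> nat" where
  "sparse_const k = k\<^sup>2 * (2 * k) ^ (k - 1) + 2 * k"

text \<open>If every degree is small, a family has at most \<open>k\<^sup>2 u\<^sup>2 n ^ (k - 2)\<close> edges, whereas the extremal
  family has at least \<open>u (n / 2 k) ^ (k - 1)\<close>; the second wins once \<open>n\<close> is a large multiple of \<open>u\<close>.\<close>

lemma crude_lt_hitting:
  assumes k: "2 \<le> k" and u: "u > 0" and n: "n \<ge> sparse_const k * u"
  shows "k\<^sup>2 * u\<^sup>2 * n ^ (k - 2) + (n - u choose k) < (n choose k)"
proof -
  have "k\<^sup>2 * (2 * k) ^ (k - 1) * u + 2 * k * u \<le> n" and "2 * k * u > 0"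
    using n k u by (simp_all add: sparse_const_def add_mult_distrib)
  then have n2: "2 * k * u \<le> n" and K: "k\<^sup>2 * (2 * k) ^ (k - 1) * u < n" by linarith+
  have un: "2 * u \<le> n" using n2 k by (metis le_trans mult_le_mono1 mult.commute mult_le_mono2 le_numeral_extra(4) mult.right_neutral one_le_numeral numeral_le_one_iff)
  have kn: "k - 1 \<le> n - u"
  proof -
    have "k - 1 + u \<le> k * u" using k u by (cases u; cases k) auto
    thus ?thesis using n2 by linarith
  qed
  have "real (k\<^sup>2 * u * n ^ (k - 2)) * (2 * k) ^ (k - 1) = real n ^ (k - 2) * real (k\<^sup>2 * (2 * k) ^ (k - 1) * u)"
    by simp
  also have "\<dots> < real n ^ (k - 2) * real n"
    using K u un by (intro mult_strict_left_mono) (auto simp del: of_nat_mult of_nat_power)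
  also have "\<dots> = real n ^ (k - 1)"
    using k by (metis One_nat_def Suc_diff_Suc less_le_trans lessI numeral_2_eq_2 power_Suc2)
  finally have "real (k\<^sup>2 * u * n ^ (k - 2)) < (real n / (2 * k)) ^ (k - 1)"
    using k by (simp add: power_divide field_simps)
  also have "\<dots> \<le> (real (n - u) / real (k - 1)) ^ (k - 1)"
  proof (intro power_mono)
    have "real n / (2 * k) \<le> real (n - u) / real k"
      using un k by (simp add: field_simps of_nat_diff)
    also have "\<dots> \<le> real (n - u) / real (k - 1)"
      using k by (intro divide_left_mono) auto
    finally show "real n / (2 * k) \<le> real (n - u) / real (k - 1)" .
  qed auto
  also have "\<dots> \<le> real (n - u choose (k - 1))"
    using kn by (rule binomial_ge_n_over_k_pow_k)
  finally have "k\<^sup>2 * u * n ^ (k - 2) < (n - u choose (k - 1))" by linarith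
  then have "u * (k\<^sup>2 * u * n ^ (k - 2)) < u * (n - u choose (k - 1))"
    using u by (intro mult_strict_left_mono) auto
  then have "(n - u choose k) + u * (k\<^sup>2 * u * n ^ (k - 2)) < (n - u choose k) + u * (n - u choose (k - 1))"
    by (rule add_strict_left_mono)
  also have "(n - u choose k) + u * (n - u choose (k - 1)) \<le> (n - u + u choose k)"
    using k by (intro binomial_diff_bounds) auto
  finally have "(n - u choose k) + u * (k\<^sup>2 * u * n ^ (k - 2)) < (n choose k)" using un by simp
  thus ?thesis by (simp add: power2_eq_square algebra_simps)
qed

text \<open>Induction on \<open>t\<close>. A vertex whose degree exceeds the number of edges through it that can be
  blocked by a matching of size \<open>t\<close> extends every such matching, so deleting it lowers the matching
  number, and the edges through it are counted trivially. If there is no such vertex, all edges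
  meet the few vertices of a maximal matching, each of low degree, and there are too few edges.\<close>

lemma erdos_matching_sparse:
  assumes "2 \<le> k" "finite V" "F \<subseteq> nsets V k" "matching_at_most t F" "sparse_const k * t \<le> card V"
  shows "card F + (card V - t choose k) \<le> (card V choose k) \<and>
    (card F + (card V - t choose k) = (card V choose k) \<longrightarrow> (\<exists>S \<in> nsets V t. F = hits V k S))"
  using assms
proof (induction t arbitrary: V F)
  case 0
  have "F = {}"
  proof (rule ccontr)
    assume "F \<noteq> {}"
    then obtain E where "E \<in> F" by auto
    thus False using matching_at_mostD[OF 0(4), of "{E}"] by (simp add: disjoint_def)
  qed
  thus ?case by (auto simp: hits_def)
next
  case (Suc t)
  let ?n = "card V"
  define d where "d = k * Suc t * ?n ^ (k - 2)"
  have finF: "finite F" using Suc.prems finite_imp_finite_nsets finite_subset by metis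
  have edge: "E \<subseteq> V \<and> finite E \<and> card E = k" if "E \<in> F" for E
    using that Suc.prems(3) by (auto simp: nsets_def)
  have Un: "card (\<Union>N) \<le> k * Suc t" if "N \<subseteq> F" "disjoint N" for N
  proof -
    have "card (\<Union>N) \<le> card N * k"
      using that finF edge by (intro card_Union_le_mult) (auto intro: finite_subset)
    also have "\<dots> \<le> Suc t * k"
      using matching_at_mostD[OF Suc.prems(4) that] by (rule mult_le_mono1)
    finally show ?thesis by (simp add: mult.commute)
  qed
  show ?case
  proof (cases "\<exists>v\<in>V. d < card {E \<in> F. v \<in> E}")
    case True
    then obtain v where v: "v \<in> V" and deg: "d < card {E \<in> F. v \<in> E}" by auto
    define F' where "F' = {E \<in> F. v \<notin> E}"
    have n1: "card (V - {v}) = ?n - 1" "?n \<ge> 1"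
      using v Suc.prems(2) by (auto simp: Suc_le_eq card_gt_0_iff)
    have m: "matching_at_most t F'"
      unfolding matching_at_most_def
    proof (intro allI impI)
      fix N assume N: "N \<subseteq> F'" "disjoint N"
      then have NF: "N \<subseteq> F" by (auto simp: F'_def)
      have "\<Union>N \<subseteq> V" using NF edge by blast
      have "card {E \<in> nsets V k. v \<in> E \<and> E \<inter> \<Union>N \<noteq> {}} \<le> card (\<Union>N) * ?n ^ (k - 2)"
        using \<open>\<Union>N \<subseteq> V\<close> v N Suc.prems by (intro card_edges_through_meeting) (auto simp: F'_def)
      also have "\<dots> \<le> d" unfolding d_def by (intro mult_right_mono Un NF N) auto
      finally have less: "card {E \<in> nsets V k. v \<in> E \<and> E \<inter> \<Union>N \<noteq> {}} < card {E \<in> F. v \<in> E}"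
        using deg by simp
      have "\<not> {E \<in> F. v \<in> E} \<subseteq> {E \<in> nsets V k. v \<in> E \<and> E \<inter> \<Union>N \<noteq> {}}"
        using card_mono[of "{E \<in> nsets V k. v \<in> E \<and> E \<inter> \<Union>N \<noteq> {}}" "{E \<in> F. v \<in> E}"] less Suc.prems(2)
        by (auto simp: finite_imp_finite_nsets)
      then obtain E where E: "E \<in> F" "v \<in> E" "E \<inter> \<Union>N = {}"
        using Suc.prems(3) by auto
      have "card (insert E N) \<le> Suc t"
        using E N NF by (intro matching_at_mostD[OF Suc.prems(4)] disjoint_insert_edge) auto
      moreover have "E \<notin> N" using N E by (auto simp: F'_def)
      ultimately show "card N \<le> t" using finite_subset[OF NF finF] by simp
    qed
    have F': "F' \<subseteq> nsets (V - {v}) k"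
      using Suc.prems(3) by (auto simp: F'_def nsets_def)
    have K: "sparse_const k \<ge> 1" using Suc.prems(1) by (simp add: sparse_const_def)
    have IH: "card F' + (?n - 1 - t choose k) \<le> (?n - 1 choose k)"
      and IHeq: "card F' + (?n - 1 - t choose k) = (?n - 1 choose k) \<Longrightarrow> \<exists>S\<in>nsets (V - {v}) t. F' = hits (V - {v}) k S"
      using Suc.IH[OF Suc.prems(1) _ F' m] Suc.prems(2,5) K n1 by auto
    let ?D = "{E \<in> nsets V k. v \<in> E}"
    have finD: "finite ?D" using Suc.prems(2) by (simp add: finite_imp_finite_nsets)
    have D: "?D = hits V k {v}" by (auto simp: hits_def)
    have pascal: "(?n choose k) = (?n - 1 choose (k - 1)) + (?n - 1 choose k)"
      using n1 Suc.prems(1) by (intro choose_reduce_nat) auto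
    have cardD: "card ?D = (?n - 1 choose (k - 1))"
      using card_hits[of V "{v}" k] pascal v Suc.prems(1,2) unfolding D by simp
    have split: "F = F' \<union> {E \<in> F. v \<in> E}" by (auto simp: F'_def)
    have "card F = card F' + card {E \<in> F. v \<in> E}"
      by (subst split, intro card_Un_disjoint) (use finF in \<open>auto simp: F'_def\<close>)
    moreover have sub: "{E \<in> F. v \<in> E} \<subseteq> ?D" using Suc.prems(3) by auto
    moreover have le: "card {E \<in> F. v \<in> E} \<le> card ?D" by (rule card_mono[OF finD sub])
    ultimately have bound: "card F + (?n - Suc t choose k) \<le> (?n choose k)"
      using IH cardD pascal by simp
    show ?thesis
    proof (intro conjI impI bound)
      assume eq: "card F + (?n - Suc t choose k) = (?n choose k)"
      with \<open>card F = _\<close> IH cardD pascal le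
      have 1: "card F' + (?n - 1 - t choose k) = (?n - 1 choose k)" and 2: "card {E \<in> F. v \<in> E} = card ?D"
        by auto
      from IHeq[OF 1] obtain S where S: "S \<in> nsets (V - {v}) t" "F' = hits (V - {v}) k S" by auto
      have 3: "{E \<in> F. v \<in> E} = ?D" using card_subset_eq[OF finD sub 2] .
      have "F = hits V k (insert v S)"
        by (subst split, subst 3, subst S(2)) (auto simp: hits_def nsets_def)
      moreover have "insert v S \<in> nsets V (Suc t)"
        using S(1) v by (auto simp: nsets_def card_insert_if)
      ultimately show "\<exists>S\<in>nsets V (Suc t). F = hits V k S" by blast
    qed
  next
    case False
    have "finite {N. N \<subseteq> F \<and> disjoint N}" using finF by simp
    from finite_has_maximal2[OF this, of "{}"] obtain N where "N \<in> {N. N \<subseteq> F \<and> disjoint N}"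
      and Nmax: "\<forall>N'\<in>{N. N \<subseteq> F \<and> disjoint N}. N \<le> N' \<longrightarrow> N = N'"
      by auto
    then have N: "N \<subseteq> F" "disjoint N" by auto
    have max: "N' = N" if "N' \<subseteq> F" "disjoint N'" "N \<subseteq> N'" for N'
      using Nmax that by blast
    have meets: "E \<inter> \<Union>N \<noteq> {}" if "E \<in> F" for E
    proof
      assume E: "E \<inter> \<Union>N = {}"
      have "insert E N = N"
        using that N E by (intro max disjoint_insert_edge) auto
      then have "E = {}" using E by blast
      thus False using edge[OF that] Suc.prems(1) by simp
    qed
    have NV: "\<Union>N \<subseteq> V" using N edge by blast
    then have finU: "finite (\<Union>N)" using Suc.prems(2) finite_subset by blast
    have "F \<subseteq> (\<Union>v\<in>\<Union>N. {E \<in> F. v \<in> E})" using meets by blast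
    then have "card F \<le> card (\<Union>v\<in>\<Union>N. {E \<in> F. v \<in> E})"
      using finF by (intro card_mono finite_subset[of "\<Union>v\<in>\<Union>N. {E \<in> F. v \<in> E}" F]) auto
    also have "\<dots> \<le> (\<Sum>v\<in>\<Union>N. card {E \<in> F. v \<in> E})" by (rule card_UN_le[OF finU])
    also have "\<dots> \<le> card (\<Union>N) * d"
      using sum_bounded_above[of "\<Union>N" "\<lambda>v. card {E \<in> F. v \<in> E}" d] False NV by (auto simp: not_less)
    also have "\<dots> \<le> k * Suc t * d" by (intro mult_right_mono Un N) auto
    also have "\<dots> = k\<^sup>2 * (Suc t)\<^sup>2 * ?n ^ (k - 2)" by (simp add: d_def power2_eq_square algebra_simps)
    finally have "card F + (?n - Suc t choose k) < (?n choose k)"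
      using crude_lt_hitting[OF Suc.prems(1) _ Suc.prems(5)] by simp
    thus ?thesis by simp
  qed
qed

section \<open>Shifting\<close>

definition moves :: "'a \<Rightarrow> 'a \<Rightarrow> 'a set set \<Rightarrow> 'a set \<Rightarrow> bool" where
  "moves i j F E \<longleftrightarrow> j \<in> E \<and> i \<notin> E \<and> insert i (E - {j}) \<notin> F"

definition shift :: "'a \<Rightarrow> 'a \<Rightarrow> 'a set set \<Rightarrow> 'a set set" where
  "shift i j F = (\<lambda>E. if moves i j F E then insert i (E - {j}) else E) ` F"

lemma shift_cases:
  assumes "E \<in> shift i j F"
  obtains (stay) "E \<in> F" "\<not> moves i j F E"
  | (new) E0 where "E0 \<in> F" "moves i j F E0" "E = insert i (E0 - {j})" "E \<notin> F"
proof -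
  from assms obtain E0 where E0: "E0 \<in> F" "E = (if moves i j F E0 then insert i (E0 - {j}) else E0)"
    unfolding shift_def by blast
  show thesis
  proof (cases "moves i j F E0")
    case True
    thus thesis using E0 new by (simp add: moves_def)
  next
    case False
    thus thesis using E0 stay by simp
  qed
qed

lemma inj_on_shift: "inj_on (\<lambda>E. if moves i j F E then insert i (E - {j}) else E) F"
proof (rule inj_onI)
  fix A B assume "A \<in> F" "B \<in> F"
    "(if moves i j F A then insert i (A - {j}) else A) = (if moves i j F B then insert i (B - {j}) else B)"
  moreover have "A = B" if "insert i (A - {j}) = insert i (B - {j})" "moves i j F A" "moves i j F B"
    using that unfolding moves_def by (metis Diff_insert_absorb insert_Diff insert_absorb2 insert_commute Diff_iff)
  ultimately show "A = B" unfolding moves_def by (auto split: if_splits)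
qed

lemma card_shift: "card (shift i j F) = card F"
  unfolding shift_def by (rule card_image[OF inj_on_shift])

lemma shift_nsets:
  assumes "F \<subseteq> nsets V k" "i \<in> V"
  shows "shift i j F \<subseteq> nsets V k"
proof
  fix E assume "E \<in> shift i j F"
  then show "E \<in> nsets V k"
  proof (cases rule: shift_cases)
    case stay thus ?thesis using assms by auto
  next
    case (new E0)
    then have "E0 \<subseteq> V" "finite E0" "card E0 = k" "j \<in> E0" "i \<notin> E0"
      using assms by (auto simp: nsets_def moves_def)
    moreover from this have "k > 0" by (auto simp: card_gt_0_iff)
    ultimately show ?thesis unfolding new(3) using assms(2) by (auto simp: nsets_def)
  qed
qed

text \<open>A matching of the shifted family contains at most one edge that is not in \<open>F\<close>, because all
  such edges contain \<open>i\<close>. Undoing its move can only collide with the edge through \<open>j\<close>; that edge did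
  not move, so its own shift lies in \<open>F\<close> and exchanging \<open>i\<close> and \<open>j\<close> between the two edges repairs the
  matching.\<close>

lemma shift_matching:
  assumes F: "matching_at_most t F" "finite F"
  shows "matching_at_most t (shift i j F)"
  unfolding matching_at_most_def
proof (intro allI impI)
  fix N assume N: "N \<subseteq> shift i j F" "disjoint N"
  have dj: "A \<inter> B = {}" if "A \<in> N" "B \<in> N" "A \<noteq> B" for A B
    using N(2) that by (auto simp: disjoint_def)
  have djD: "disjoint M" if "M \<subseteq> N" for M using N(2) that by (auto simp: disjoint_def)
  have finN: "finite N" using N(1) F(2) by (auto simp: shift_def intro: finite_subset)
  show "card N \<le> t"
  proof (cases "N \<subseteq> F")
    case True
    thus ?thesis using matching_at_mostD[OF F(1)] N by auto
  next
    case False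
    then obtain E where E: "E \<in> N" "E \<notin> F" by auto
    from N(1) E have "E \<in> shift i j F" by auto
    then obtain E0 where E0: "E0 \<in> F" "moves i j F E0" "E = insert i (E0 - {j})"
      by (cases rule: shift_cases) (use E in auto)
    have ij: "i \<in> E" "j \<in> E0" "i \<notin> E0" "i \<noteq> j" "j \<notin> E" using E0 by (auto simp: moves_def)
    have rest: "D \<in> F \<and> \<not> moves i j F D \<and> i \<notin> D" if "D \<in> N" "D \<noteq> E" for D
    proof -
      have "i \<notin> D" using dj[OF that(1) E(1) that(2)] ij by auto
      from N(1) that have "D \<in> shift i j F" by auto
      thus ?thesis by (cases rule: shift_cases) (use \<open>i \<notin> D\<close> in auto)
    qed
    have E0E: "E0 \<subseteq> insert j E" using E0 by auto
    show ?thesis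
    proof (cases "\<exists>D\<in>N. j \<in> D")
      case False
      let ?N = "insert E0 (N - {E})"
      have E0N: "E0 \<inter> D = {}" if "D \<in> N - {E}" for D
        using dj[of D E] E(1) that False E0E by auto
      have "E0 \<notin> N" using False ij by auto
      have "E0 \<inter> \<Union>(N - {E}) = {}" using E0N by blast
      then have "disjoint ?N" by (intro disjoint_insert_edge djD) auto
      moreover have "?N \<subseteq> F" using E0 rest by auto
      ultimately have "card ?N \<le> t" by (intro matching_at_mostD[OF F(1)])
      thus ?thesis using \<open>E0 \<notin> N\<close> E finN by (simp add: card_Diff_singleton card_gt_0_iff Suc_diff_Suc
        card_Suc_Diff1)
    next
      case True
      then obtain D where D: "D \<in> N" "j \<in> D" by auto
      have DE: "D \<noteq> E" using D ij by auto
      let ?D = "insert i (D - {j})"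
      have D': "?D \<in> F" using rest[OF D(1) DE] D by (auto simp: moves_def)
      let ?N = "insert E0 (insert ?D (N - {E} - {D}))"
      have others: "E0 \<inter> C = {}" "?D \<inter> C = {}" if "C \<in> N - {E} - {D}" for C
        using dj[of C E] dj[of C D] E(1) D that E0E ij by auto
      have "E0 \<inter> ?D = {}" using dj[OF D(1) E(1) DE] E0 ij by auto
      moreover have "E0 \<inter> \<Union>(N - {E} - {D}) = {}" "?D \<inter> \<Union>(N - {E} - {D}) = {}"
        using others by blast+
      ultimately have "disjoint ?N"
        by (intro disjoint_insert_edge djD) auto
      moreover have "?N \<subseteq> F" using E0 D' rest by auto
      ultimately have "card ?N \<le> t" by (intro matching_at_mostD[OF F(1)])
      moreover have "E0 \<notin> insert ?D (N - {E} - {D})"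
      proof -
        have "E0 \<noteq> ?D" using ij by auto
        moreover have "E0 \<notin> N - {E} - {D}" using others(1)[of E0] ij(2) by auto
        ultimately show ?thesis by auto
      qed
      moreover have "?D \<notin> N - {E} - {D}" using others(2)[of ?D] by auto
      moreover have "card N = Suc (Suc (card (N - {E} - {D})))"
        using finN E(1) D(1) DE by (metis card_Suc_Diff1 finite_Diff insert_Diff insert_iff)
      ultimately show ?thesis using finN by simp
    qed
  qed
qed

text \<open>Shifting never touches a set containing both or neither of \<open>i\<close> and \<open>j\<close>; the other sets come in
  pairs \<open>{C + i, C + j}\<close>, and within a pair the result depends only on how many members are present.\<close>

lemma shift_mem_other:
  assumes "i \<in> E \<longleftrightarrow> j \<in> E"
  shows "E \<in> shift i j F \<longleftrightarrow> E \<in> F"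
proof
  assume "E \<in> shift i j F"
  thus "E \<in> F" using assms by (cases rule: shift_cases) (auto simp: moves_def)
next
  assume "E \<in> F"
  thus "E \<in> shift i j F" unfolding shift_def
    by (intro image_eqI[of _ _ E]) (use assms in \<open>auto simp: moves_def\<close>)
qed

lemma shift_mem_low:
  assumes "i \<notin> C" "j \<notin> C" "i \<noteq> j"
  shows "insert i C \<in> shift i j F \<longleftrightarrow> insert i C \<in> F \<or> insert j C \<in> F"
proof
  assume "insert i C \<in> shift i j F"
  thus "insert i C \<in> F \<or> insert j C \<in> F"
  proof (cases rule: shift_cases)
    case (new E0)
    then have "E0 = insert j C" using assms by (auto simp: moves_def)
    thus ?thesis using new by auto
  qed auto
next
  assume *: "insert i C \<in> F \<or> insert j C \<in> F"
  show "insert i C \<in> shift i j F"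
  proof (cases "insert i C \<in> F")
    case True
    thus ?thesis unfolding shift_def
      by (intro image_eqI[of _ _ "insert i C"]) (use assms in \<open>auto simp: moves_def\<close>)
  next
    case False
    thus ?thesis unfolding shift_def
      by (intro image_eqI[of _ _ "insert j C"]) (use assms * in \<open>auto simp: moves_def\<close>)
  qed
qed

lemma shift_mem_high:
  assumes "i \<notin> C" "j \<notin> C" "i \<noteq> j"
  shows "insert j C \<in> shift i j F \<longleftrightarrow> insert i C \<in> F \<and> insert j C \<in> F"
proof
  assume "insert j C \<in> shift i j F"
  thus "insert i C \<in> F \<and> insert j C \<in> F"
    by (cases rule: shift_cases) (use assms in \<open>auto simp: moves_def\<close>)
next
  assume "insert i C \<in> F \<and> insert j C \<in> F"
  thus "insert j C \<in> shift i j F" unfolding shift_def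
    by (intro image_eqI[of _ _ "insert j C"]) (use assms in \<open>auto simp: moves_def\<close>)
qed

section \<open>Extending a matching through good vertices\<close>

text \<open>If \<open>A\<close> is large enough to hold disjoint edges for all of \<open>N\<close> and \<open>G\<close>, the vertices of \<open>G\<close> can be
  completed to edges one after the other inside what is left of \<open>A\<close>.\<close>

lemma extend_matching:
  assumes "finite G" "finite A" "0 < k" "finite N" "N \<subseteq> F" "disjoint N" "\<And>E. E \<in> F \<Longrightarrow> card E = k \<and> finite E"
    and "\<Union>N \<inter> G = {}"
    and good: "\<And>v C. v \<in> G \<Longrightarrow> C \<in> nsets (A - {v}) (k - 1) \<Longrightarrow> insert v C \<in> F"
    and "k * (card G + card N) \<le> card A"
  shows "\<exists>N'\<subseteq>F. disjoint N' \<and> card N' = card G + card N"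
  using assms
proof (induction G arbitrary: N rule: finite_induct)
  case empty
  thus ?case by auto
next
  case (insert v G)
  let ?R = "A - insert v G - \<Union>N"
  have finU: "finite (\<Union>N)" using insert.prems by auto
  have "card (\<Union>N) \<le> card N * k"
    using insert.prems by (intro card_Union_le_mult) auto
  moreover have "card A - card (insert v G) - card (\<Union>N) \<le> card ?R"
    using finU insert.hyps by (metis diff_card_le_card_Diff diff_le_mono finite_insert le_trans)
  moreover have "card (insert v G) = Suc (card G)" using insert.hyps by simp
  moreover have "(k - 1) + Suc (card G) + card N * k \<le> k * (Suc (card G) + card N)"
    using insert.prems(2) by (cases k) (auto simp: algebra_simps)
  ultimately have "k - 1 \<le> card ?R" using insert.prems(9) by simp
  then obtain C where C: "C \<subseteq> ?R" "card C = k - 1" "finite C"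
    using obtain_subset_with_card_n by metis
  let ?E = "insert v C"
  have EF: "?E \<in> F"
    using C by (intro insert.prems(8)) (auto simp: nsets_def)
  have disj: "?E \<inter> \<Union>N = {}" using C insert.prems(7) by auto
  then have EN: "?E \<notin> N" by auto
  have "\<exists>N'\<subseteq>F. disjoint N' \<and> card N' = card G + card (insert ?E N)"
  proof (rule insert.IH)
    show "disjoint (insert ?E N)" using disj insert.prems(5) by (intro disjoint_insert_edge)
    show "\<Union>(insert ?E N) \<inter> G = {}" using C insert.prems(7) insert.hyps by auto
    show "k * (card G + card (insert ?E N)) \<le> card A"
      using insert.prems(3,9) insert.hyps EN by simp
  qed (use insert.prems EF in auto)
  thus ?case using EN insert.prems(3) insert.hyps by simp
qed

section \<open>Undoing a shift of an extremal family\<close>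

text \<open>Walk from \<open>C\<close> to \<open>D\<close> by replacing one element at a time. Two sets differing in one element have
  a common disjoint set, which forces equal colours.\<close>

lemma kneser_connected:
  assumes V: "finite V" "2 * r + 1 \<le> card V"
    and alt: "\<And>C D. C \<in> nsets V r \<Longrightarrow> D \<in> nsets V r \<Longrightarrow> C \<inter> D = {} \<Longrightarrow> P C \<longleftrightarrow> P D"
    and "C \<in> nsets V r" "D \<in> nsets V r"
  shows "P C \<longleftrightarrow> P D"
  using assms(4,5)
proof (induction "card (D - C)" arbitrary: C)
  case 0
  then have "D \<subseteq> C" "finite C" "card C = card D" by (auto simp: nsets_def)
  then have "C = D" by (metis card_subset_eq)
  thus ?case by simp
next
  case (Suc m)
  have fin: "finite C" "finite D" "card C = r" "card D = r" "C \<subseteq> V" "D \<subseteq> V" using Suc.prems by (auto simp: nsets_def)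
  obtain y where y: "y \<in> D" "y \<notin> C" using Suc.hyps(2) by (metis Diff_iff card.empty nat.distinct(1) ex_in_conv)
  have "\<not> C \<subseteq> D" using fin y by (metis card_subset_eq)
  then obtain x where x: "x \<in> C" "x \<notin> D" by auto
  let ?C = "insert y (C - {x})"
  have rpos: "r > 0" using fin x by (auto simp: card_gt_0_iff)
  have C': "?C \<in> nsets V r"
    using fin y x rpos by (auto simp: nsets_def card_insert_if)
  have "r \<le> card (V - insert y C)"
    using V fin y by (subst card_Diff_subset) auto
  then obtain B where B: "B \<subseteq> V - insert y C" "card B = r" "finite B"
    using obtain_subset_with_card_n by metis
  have "D - ?C = (D - C) - {y}" using x by auto
  then have "card (D - ?C) = m" using Suc.hyps(2) fin y by simp
  then have "P ?C \<longleftrightarrow> P D" using Suc.hyps(1)[of ?C] C' Suc.prems(2) by simp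
  moreover have BV: "B \<in> nsets V r" using B by (auto simp: nsets_def)
  then have "P C \<longleftrightarrow> P B" using Suc.prems(1) B by (intro alt) auto
  moreover have "P ?C \<longleftrightarrow> P B" using C' BV B by (intro alt) auto
  ultimately show ?case by simp
qed

text \<open>Let \<open>H = hits V k S\<close> be the shift. Only the pairs \<open>{C + i, C + j}\<close> with \<open>C\<close> disjoint from \<open>S\<close> and
  \<open>S \<inter> {i, j} = {i}\<close> leave a choice: exactly one of the two sets is in \<open>F\<close>. If disjoint \<open>C\<close> and \<open>D\<close> made
  different choices, the edges \<open>C + i\<close> and \<open>D + j\<close> together with one edge through each other vertex
  of \<open>S\<close> would form a matching of size \<open>s + 1\<close>. So all choices agree, and \<open>F\<close> is the family hitting \<open>S\<close>
  or the one hitting \<open>S\<close> with \<open>i\<close> replaced by \<open>j\<close>.\<close>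

lemma unshift_hits:
  assumes k: "2 \<le> k" and V: "finite V" "i \<in> V" "j \<in> V" "i \<noteq> j"
    and F: "F \<subseteq> nsets V k" "matching_at_most s F"
    and S: "S \<in> nsets V s" and H: "shift i j F = hits V k S"
    and n: "k * (s + 1) \<le> card V" "s + 2 * k \<le> card V"
  shows "\<exists>S'\<in>nsets V s. F = hits V k S'"
proof -
  have S': "S \<subseteq> V" "finite S" "card S = s" using S by (auto simp: nsets_def)
  have inV: "insert a C \<in> nsets V k \<longleftrightarrow> C \<in> nsets V (k - 1)" if "a \<in> V" "a \<notin> C" for a C
    using that k by (auto simp: nsets_def)
  have pair: "E \<in> F \<longleftrightarrow> E \<in> nsets V k \<and> P E"
    if other: "\<And>E. (i \<in> E \<longleftrightarrow> j \<in> E) \<Longrightarrow> E \<in> nsets V k \<Longrightarrow> (E \<in> F \<longleftrightarrow> P E)"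
      and i: "\<And>C. i \<notin> C \<Longrightarrow> j \<notin> C \<Longrightarrow> C \<in> nsets V (k - 1) \<Longrightarrow> (insert i C \<in> F \<longleftrightarrow> P (insert i C))"
      and j: "\<And>C. i \<notin> C \<Longrightarrow> j \<notin> C \<Longrightarrow> C \<in> nsets V (k - 1) \<Longrightarrow> (insert j C \<in> F \<longleftrightarrow> P (insert j C))"
    for E P
  proof (cases "E \<in> nsets V k")
    case True
    consider "i \<in> E \<longleftrightarrow> j \<in> E" | "i \<in> E" "j \<notin> E" | "j \<in> E" "i \<notin> E" by blast
    thus ?thesis
    proof cases
      case 1 thus ?thesis using other True by simp
    next
      case 2
      then have "insert i (E - {i}) = E" by auto
      thus ?thesis using i[of "E - {i}"] inV[of i "E - {i}"] 2 True V by simp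
    next
      case 3
      then have "insert j (E - {j}) = E" by auto
      thus ?thesis using j[of "E - {j}"] inV[of j "E - {j}"] 3 True V by simp
    qed
  qed (use F in auto)
  have low: "insert i C \<in> F \<or> insert j C \<in> F \<longleftrightarrow> insert i C \<inter> S \<noteq> {}"
    and high: "insert i C \<in> F \<and> insert j C \<in> F \<longleftrightarrow> insert j C \<inter> S \<noteq> {}"
    if "i \<notin> C" "j \<notin> C" "C \<in> nsets V (k - 1)" for C
    using shift_mem_low[OF that(1,2) V(4), of F] shift_mem_high[OF that(1,2) V(4), of F] that V inV
    unfolding H hits_def by auto
  have other: "E \<in> F \<longleftrightarrow> E \<inter> S \<noteq> {}" if "i \<in> E \<longleftrightarrow> j \<in> E" "E \<in> nsets V k" for E
    using shift_mem_other[OF that(1), of F] that(2) unfolding H hits_def by auto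
  let ?W = "V - insert j (insert i S)"
  have finW: "finite ?W" using V by simp
  have memW: "C \<in> nsets ?W (k - 1) \<Longrightarrow> i \<notin> C \<and> j \<notin> C \<and> C \<inter> S = {} \<and> C \<in> nsets V (k - 1)" for C
    by (auto simp: nsets_def)
  consider "i \<in> S \<longleftrightarrow> j \<in> S" | "i \<notin> S" "j \<in> S" | "i \<in> S" "j \<notin> S" by blast
  thus ?thesis
  proof cases
    case 1
    have "E \<in> F \<longleftrightarrow> E \<in> nsets V k \<and> E \<inter> S \<noteq> {}" for E
    proof (rule pair)
      fix C assume C: "i \<notin> C" "j \<notin> C" "C \<in> nsets V (k - 1)"
      show "insert i C \<in> F \<longleftrightarrow> insert i C \<inter> S \<noteq> {}" "insert j C \<in> F \<longleftrightarrow> insert j C \<inter> S \<noteq> {}"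
        using low[OF C] high[OF C] 1 by auto
    qed (rule other)
    then have "F = hits V k S" by (auto simp: hits_def)
    thus ?thesis using S by blast
  next
    case 2
    have "card (insert j (insert i S)) \<le> s + 1" using 2 S' by (auto simp: insert_absorb)
    moreover have "card V - card (insert j (insert i S)) \<le> card ?W"
      using S' by (intro diff_card_le_card_Diff) auto
    ultimately have "k - 1 \<le> card ?W" using n k by linarith
    then obtain C where "C \<subseteq> ?W" "card C = k - 1" "finite C"
      using obtain_subset_with_card_n by metis
    then have C: "C \<in> nsets ?W (k - 1)" by (auto simp: nsets_def)
    have "False" using low[of C] high[of C] memW[OF C] 2 by auto
    thus ?thesis ..
  next
    case 3
    have "card (insert j (insert i S)) \<le> s + 1" using 3 S' by (auto simp: insert_absorb)
    moreover have "card V - card (insert j (insert i S)) \<le> card ?W"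
      using S' by (intro diff_card_le_card_Diff) auto
    ultimately have cW: "2 * (k - 1) + 1 \<le> card ?W" using n k by linarith
    define P where "P C \<longleftrightarrow> insert i C \<in> F" for C
    have Pj: "insert j C \<in> F \<longleftrightarrow> \<not> P C" if "C \<in> nsets ?W (k - 1)" for C
      using low[of C] high[of C] memW[OF that] 3 unfolding P_def by auto
    have imp: "P D" if CD: "C \<in> nsets ?W (k - 1)" "D \<in> nsets ?W (k - 1)" "C \<inter> D = {}" "P C" for C D
    proof (rule ccontr)
      assume "\<not> P D"
      then have inF: "insert i C \<in> F" "insert j D \<in> F" using Pj CD by (auto simp: P_def)
      let ?N = "{insert i C, insert j D}"
      have djN: "disjoint ?N" using CD memW[OF CD(1)] memW[OF CD(2)] V by (auto simp: disjoint_def)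
      have ne: "insert i C \<noteq> insert j D" using CD memW[OF CD(1)] memW[OF CD(2)] V by auto
      have good: "insert v B \<in> F" if "v \<in> S - {i}" "B \<in> nsets (V - {v}) (k - 1)" for v B
      proof -
        have v: "v \<in> S" "v \<in> V" "v \<noteq> i" "v \<noteq> j" "v \<notin> B" using that S' 3 by (auto simp: nsets_def)
        have B: "insert v B \<in> nsets V k" using that v inV[of v B] by (auto simp: nsets_def)
        consider "i \<in> B \<longleftrightarrow> j \<in> B" | "i \<in> B" "j \<notin> B" | "j \<in> B" "i \<notin> B" by blast
        thus ?thesis
        proof cases
          case 1
          thus ?thesis using other[of "insert v B"] B v by auto
        next
          case 2
          have E: "insert i (insert v B - {i}) = insert v B" using 2 by auto
          have "insert v B - {i} \<in> nsets V (k - 1)" using inV[of i "insert v B - {i}"] B V E by simp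
          then have "insert i (insert v B - {i}) \<in> F" using high[of "insert v B - {i}"] v 2 by auto
          thus ?thesis unfolding E .
        next
          case 3
          have E: "insert j (insert v B - {j}) = insert v B" using 3 by auto
          have "insert v B - {j} \<in> nsets V (k - 1)" using inV[of j "insert v B - {j}"] B V E by simp
          then have "insert j (insert v B - {j}) \<in> F" using high[of "insert v B - {j}"] v 3 by auto
          thus ?thesis unfolding E .
        qed
      qed
      have sS: "card (S - {i}) + 1 = s" using S' 3 by (metis Suc_eq_plus1 card_Suc_Diff1)
      have "\<exists>N'\<subseteq>F. disjoint N' \<and> card N' = card (S - {i}) + card ?N"
      proof (rule extend_matching[where A = V and k = k])
        show "\<Union> ?N \<inter> (S - {i}) = {}" using memW[OF CD(1)] memW[OF CD(2)] 3 by auto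
        have "card (S - {i}) + card ?N = s + 1" using sS ne by simp
        thus "k * (card (S - {i}) + card ?N) \<le> card V" using n(1) by simp
      qed (use S' V k F inF djN good in \<open>auto simp: nsets_def\<close>)
      then obtain N' where N': "N' \<subseteq> F" "disjoint N'" "card N' = card (S - {i}) + card ?N" by blast
      then have "card N' = s + 1" using ne sS by simp
      thus False using matching_at_mostD[OF F(2) N'(1,2)] by simp
    qed
    have alt: "P C \<longleftrightarrow> P D" if "C \<in> nsets ?W (k - 1)" "D \<in> nsets ?W (k - 1)" "C \<inter> D = {}" for C D
      using imp[OF that] imp[OF that(2,1)] that(3) by (auto simp: Int_commute)
    have const: "P C \<longleftrightarrow> P D" if "C \<in> nsets ?W (k - 1)" "D \<in> nsets ?W (k - 1)" for C D
      by (rule kneser_connected[OF finW cW alt that])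
    have W: "C \<in> nsets ?W (k - 1)" if "i \<notin> C" "j \<notin> C" "C \<in> nsets V (k - 1)" "C \<inter> S = {}" for C
      using that by (auto simp: nsets_def)
    show ?thesis
    proof (cases "\<exists>C\<in>nsets ?W (k - 1). P C")
      case True
      then have all: "P C" if "C \<in> nsets ?W (k - 1)" for C using const that by blast
      have "E \<in> F \<longleftrightarrow> E \<in> nsets V k \<and> E \<inter> S \<noteq> {}" for E
      proof (rule pair)
        fix C assume C: "i \<notin> C" "j \<notin> C" "C \<in> nsets V (k - 1)"
        show "insert i C \<in> F \<longleftrightarrow> insert i C \<inter> S \<noteq> {}"
          using high[OF C] all W[OF C] 3 unfolding P_def by (cases "C \<inter> S = {}") auto
        show "insert j C \<in> F \<longleftrightarrow> insert j C \<inter> S \<noteq> {}"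
          using high[OF C] all W[OF C] 3 Pj by (cases "C \<inter> S = {}") auto
      qed (rule other)
      then have "F = hits V k S" by (auto simp: hits_def)
      thus ?thesis using S by blast
    next
      case False
      then have none: "\<not> P C" if "C \<in> nsets ?W (k - 1)" for C using that by blast
      let ?S = "insert j (S - {i})"
      have "E \<in> F \<longleftrightarrow> E \<in> nsets V k \<and> E \<inter> ?S \<noteq> {}" for E
      proof (rule pair)
        fix E assume E: "i \<in> E \<longleftrightarrow> j \<in> E" "E \<in> nsets V k"
        show "E \<in> F \<longleftrightarrow> E \<inter> ?S \<noteq> {}" using other[OF E] E 3 by auto
      next
        fix C assume C: "i \<notin> C" "j \<notin> C" "C \<in> nsets V (k - 1)"
        show "insert i C \<in> F \<longleftrightarrow> insert i C \<inter> ?S \<noteq> {}"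
          using high[OF C] none W[OF C] C 3 V(4) unfolding P_def by (cases "C \<inter> S = {}") auto
        show "insert j C \<in> F \<longleftrightarrow> insert j C \<inter> ?S \<noteq> {}"
          using high[OF C] none W[OF C] 3 Pj by (cases "C \<inter> S = {}") auto
      qed
      then have "F = hits V k ?S" by (auto simp: hits_def)
      moreover have "Suc (card (S - {i})) = s" using S' 3 by (metis card_Suc_Diff1)
      then have "?S \<in> nsets V s" using S' 3 V by (auto simp: nsets_def)
      ultimately show ?thesis by blast
    qed
  qed
qed

section \<open>Linear programming duality\<close>

text \<open>The linear inequalities \<open>a \<bullet> x \<ge> c\<close> that follow from those in \<open>I\<close> by adding and by scaling
  with nonnegative factors. Reasoning by induction over derivations avoids explicit multipliers.\<close>

inductive_set derived :: "(('a \<Rightarrow> real) \<times> real) set \<Rightarrow> (('a \<Rightarrow> real) \<times> real) set" for I where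
  base: "x \<in> I \<Longrightarrow> x \<in> derived I"
| add: "(a, c) \<in> derived I \<Longrightarrow> (b, d) \<in> derived I \<Longrightarrow> ((\<lambda>j. a j + b j), c + d) \<in> derived I"
| scale: "0 \<le> r \<Longrightarrow> (a, c) \<in> derived I \<Longrightarrow> ((\<lambda>j. r * a j), r * c) \<in> derived I"

lemma derived_subset:
  assumes "I' \<subseteq> derived I"
  shows "derived I' \<subseteq> derived I"
proof
  fix x assume "x \<in> derived I'"
  thus "x \<in> derived I"
    by induction (use assms in \<open>auto intro: derived.intros\<close>)
qed

lemma between_finite_sets:
  fixes A B :: "real set"
  assumes "finite A" "finite B" "\<And>a b. a \<in> A \<Longrightarrow> b \<in> B \<Longrightarrow> a \<le> b"
  shows "\<exists>t. (\<forall>a\<in>A. a \<le> t) \<and> (\<forall>b\<in>B. t \<le> b)"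
proof (cases "A = {}")
  case True
  show ?thesis
  proof (cases "B = {}")
    case False
    thus ?thesis using True assms by (intro exI[of _ "Min B"]) auto
  qed (use True in auto)
next
  case False
  thus ?thesis using assms by (intro exI[of _ "Max A"]) auto
qed

text \<open>Fourier--Motzkin elimination of one variable at a time.\<close>

lemma farkas:
  assumes "finite J" "finite I"
  shows "(\<exists>x. \<forall>(a, c)\<in>I. c \<le> (\<Sum>j\<in>J. a j * x j)) \<or>
    (\<exists>a c. (a, c) \<in> derived I \<and> (\<forall>j\<in>J. a j = 0) \<and> 0 < c)"
  using assms
proof (induction J arbitrary: I rule: finite_induct)
  case empty
  show ?case
  proof (cases "\<forall>(a, c)\<in>I. c \<le> 0")
    case False
    then obtain a c where "(a, c) \<in> I" "0 < c" by auto
    thus ?thesis using derived.base by blast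
  qed auto
next
  case (insert v J)
  define I0 where "I0 = {(a, c) \<in> I. a v = 0}"
  define Ip where "Ip = {(a, c) \<in> I. a v > 0}"
  define In where "In = {(a, c) \<in> I. a v < 0}"
  define comb where "comb = (\<lambda>((a, c), (b, d)). ((\<lambda>j. (- b v) * a j + a v * b j), (- b v) * c + a v * (d::real)))"
  define I' where "I' = I0 \<union> comb ` (Ip \<times> In)"
  have fin: "finite Ip" "finite In" "finite I0"
    unfolding Ip_def In_def I0_def using insert.prems by (auto intro: rev_finite_subset)
  then have "finite I'" by (simp add: I'_def)
  have sub: "I' \<subseteq> derived I"
  proof
    fix x assume "x \<in> I'"
    then consider "x \<in> I0" | a c b d where "(a, c) \<in> Ip" "(b, d) \<in> In" "x = comb ((a, c), (b, d))"
      unfolding I'_def by auto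
    thus "x \<in> derived I"
    proof cases
      case 1 thus ?thesis by (auto simp: I0_def intro: derived.base)
    next
      case 2
      have "((\<lambda>j. (- b v) * a j), (- b v) * c) \<in> derived I" "((\<lambda>j. a v * b j), a v * d) \<in> derived I"
        using 2 by (intro derived.scale derived.base; simp add: Ip_def In_def)+
      from derived.add[OF this] show ?thesis unfolding 2(3) comb_def by simp
    qed
  qed
  have zero: "fst x v = 0" if "x \<in> derived I'" for x
    using that
  proof induction
    case (base x)
    thus ?case by (auto simp: I'_def I0_def comb_def)
  qed auto
  from insert.IH[OF \<open>finite I'\<close>] show ?case
  proof
    assume "\<exists>a c. (a, c) \<in> derived I' \<and> (\<forall>j\<in>J. a j = 0) \<and> 0 < c"
    then obtain a c where ac: "(a, c) \<in> derived I'" "\<forall>j\<in>J. a j = 0" "0 < c" by blast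
    moreover have "a v = 0" using zero[OF ac(1)] by simp
    ultimately show ?thesis using derived_subset[OF sub] by blast
  next
    assume "\<exists>x. \<forall>(a, c)\<in>I'. c \<le> (\<Sum>j\<in>J. a j * x j)"
    then obtain x where x: "\<And>a c. (a, c) \<in> I' \<Longrightarrow> c \<le> (\<Sum>j\<in>J. a j * x j)" by auto
    define bd where "bd = (\<lambda>(a, c). (c - (\<Sum>j\<in>J. a j * x j)) / a v)"
    have "\<exists>t. (\<forall>l\<in>bd ` Ip. l \<le> t) \<and> (\<forall>h\<in>bd ` In. t \<le> h)"
    proof (rule between_finite_sets)
      fix l h assume "l \<in> bd ` Ip" "h \<in> bd ` In"
      then obtain a c b d where ab: "(a, c) \<in> Ip" "l = bd (a, c)" "(b, d) \<in> In" "h = bd (b, d)" by auto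
      then have pos: "a v > 0" "b v < 0" by (auto simp: Ip_def In_def)
      have "comb ((a, c), (b, d)) \<in> I'" using ab by (auto simp: I'_def)
      from x[OF this[unfolded comb_def split]]
      have "(- b v) * c + a v * d \<le> (\<Sum>j\<in>J. ((- b v) * a j + a v * b j) * x j)" .
      also have "\<dots> = (- b v) * (\<Sum>j\<in>J. a j * x j) + a v * (\<Sum>j\<in>J. b j * x j)"
        unfolding sum_distrib_left sum.distrib [symmetric]
        by (intro sum.cong) (auto simp: algebra_simps)
      finally have "(- b v) * (c - (\<Sum>j\<in>J. a j * x j)) \<le> a v * ((\<Sum>j\<in>J. b j * x j) - d)"
        by (simp add: algebra_simps)
      then show "l \<le> h" unfolding ab bd_def split using pos
        by (simp add: field_simps)
    qed (use fin in auto)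
    then obtain t where t: "\<And>p. p \<in> Ip \<Longrightarrow> bd p \<le> t" "\<And>p. p \<in> In \<Longrightarrow> t \<le> bd p" by auto
    have "c \<le> (\<Sum>j\<in>insert v J. a j * (x(v := t)) j)" if "(a, c) \<in> I" for a c
    proof -
      have S: "(\<Sum>j\<in>insert v J. a j * (x(v := t)) j) = a v * t + (\<Sum>j\<in>J. a j * x j)"
        using insert.hyps by (auto intro!: sum.cong)
      consider "a v = 0" | "a v > 0" | "a v < 0" by linarith
      thus ?thesis
      proof cases
        case 1
        thus ?thesis using x[of a c] that unfolding S by (simp add: I'_def I0_def)
      next
        case 2
        then have "bd (a, c) \<le> t" using that t(1)[of "(a, c)"] by (simp add: Ip_def)
        thus ?thesis unfolding S using 2 by (simp add: bd_def field_simps)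
      next
        case 3
        then have "t \<le> bd (a, c)" using that t(2)[of "(a, c)"] by (simp add: In_def)
        thus ?thesis unfolding S using 3 by (simp add: bd_def field_simps)
      qed
    qed
    thus ?thesis by blast
  qed
qed

text \<open>Duality between fractional matchings \<open>y\<close> and fractional covers \<open>w\<close>, for an arbitrary incidence
  matrix \<open>A\<close>. A derivation of a contradiction from the inequalities for \<open>w\<close> is, up to scaling, a
  fractional matching of weight larger than \<open>c\<close>.\<close>

lemma fractional_cover_exists:
  fixes A :: "'p \<Rightarrow> 'b \<Rightarrow> real"
  assumes P: "finite P" and B: "finite B"
    and weight: "\<And>y. (\<And>p. 0 \<le> y p) \<Longrightarrow> (\<And>b. b \<in> B \<Longrightarrow> (\<Sum>p\<in>P. y p * A p b) \<le> 1) \<Longrightarrow> (\<Sum>p\<in>P. y p) \<le> c"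
  shows "\<exists>w. (\<forall>b\<in>B. 0 \<le> w b) \<and> (\<Sum>b\<in>B. w b) \<le> c \<and> (\<forall>p\<in>P. 1 \<le> (\<Sum>b\<in>B. A p b * w b))"
proof -
  define I where "I = (\<lambda>p. (A p, 1)) ` P \<union> (\<lambda>b. (\<lambda>j. if j = b then 1 else 0, 0)) ` B \<union> {(\<lambda>_. -1, - c)}"
  define Q where "Q x y \<mu> l \<longleftrightarrow> (\<forall>p. 0 \<le> y p) \<and> (\<forall>b. 0 \<le> \<mu> b) \<and> 0 \<le> l \<and>
      (\<forall>b\<in>B. fst x b = (\<Sum>p\<in>P. y p * A p b) + \<mu> b - l) \<and> snd x = (\<Sum>p\<in>P. y p) - l * c"
    for x :: "('b \<Rightarrow> real) \<times> real" and y \<mu> l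
  have form: "\<exists>y \<mu> l. Q x y \<mu> l" if "x \<in> derived I" for x
    using that
  proof induction
    case (base x)
    then consider p where "p \<in> P" "x = (A p, 1)" | b where "b \<in> B" "x = (\<lambda>j. if j = b then 1 else 0, 0)"
      | "x = (\<lambda>_. -1, - c)" unfolding I_def by blast
    thus ?case
    proof cases
      case 1
      have "(\<Sum>q\<in>P. (if q = p then 1 else 0) * A q b) = (\<Sum>q\<in>P. if q = p then A q b else 0)" for b
        by (rule sum.cong) auto
      then have "Q x (\<lambda>q. if q = p then 1 else 0) (\<lambda>_. 0) 0"
        using 1 P by (simp add: Q_def sum.delta)
      thus ?thesis by blast
    next
      case 2
      then have "Q x (\<lambda>_. 0) (\<lambda>j. if j = b then 1 else 0) 0" by (simp add: Q_def)
      thus ?thesis by blast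
    next
      case 3
      then have "Q x (\<lambda>_. 0) (\<lambda>_. 0) 1" by (simp add: Q_def)
      thus ?thesis by blast
    qed
  next
    case (add a c' b d)
    then obtain y \<mu> l y' \<mu>' l' where "Q (a, c') y \<mu> l" "Q (b, d) y' \<mu>' l'" by blast
    then have "Q (\<lambda>j. a j + b j, c' + d) (\<lambda>p. y p + y' p) (\<lambda>b. \<mu> b + \<mu>' b) (l + l')"
      by (simp add: Q_def sum.distrib distrib_right)
    thus ?case by blast
  next
    case (scale r a c')
    then obtain y \<mu> l where "Q (a, c') y \<mu> l" by blast
    then have "Q (\<lambda>j. r * a j, r * c') (\<lambda>p. r * y p) (\<lambda>b. r * \<mu> b) (r * l)"
      using scale(1) by (simp add: Q_def sum_distrib_left right_diff_distrib distrib_left mult.assoc)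
    thus ?case by blast
  qed
  have "\<not> (\<exists>a c'. (a, c') \<in> derived I \<and> (\<forall>j\<in>B. a j = 0) \<and> 0 < c')"
  proof
    assume "\<exists>a c'. (a, c') \<in> derived I \<and> (\<forall>j\<in>B. a j = 0) \<and> 0 < c'"
    then obtain a c' where ac: "(a, c') \<in> derived I" "\<And>j. j \<in> B \<Longrightarrow> a j = 0" "0 < c'" by blast
    from form[OF ac(1)] obtain y \<mu> l where "Q (a, c') y \<mu> l" by blast
    then have y: "\<And>p. 0 \<le> y p" "\<And>b. 0 \<le> \<mu> b" "0 \<le> l"
      "\<And>b. b \<in> B \<Longrightarrow> a b = (\<Sum>p\<in>P. y p * A p b) + \<mu> b - l" "c' = (\<Sum>p\<in>P. y p) - l * c"
      by (simp_all add: Q_def)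
    have load: "(\<Sum>p\<in>P. y p * A p b) \<le> l" if "b \<in> B" for b
      using y(2)[of b] y(4)[OF that] ac(2)[OF that] by linarith
    show False
    proof (cases "l = 0")
      case False
      then have "l > 0" using y(3) by simp
      have "(\<Sum>p\<in>P. y p / l) \<le> c"
        using load y(1) \<open>l > 0\<close> by (intro weight) (auto simp: field_simps simp flip: sum_divide_distrib)
      then have "(\<Sum>p\<in>P. y p) \<le> l * c"
        using \<open>l > 0\<close> by (simp add: field_simps flip: sum_divide_distrib)
      thus False using y(5) ac(3) by simp
    next
      case True
      \<comment> \<open>All loads vanish, so every multiple of \<open>y\<close> is a fractional matching.\<close>
      define Y where "Y = (\<Sum>p\<in>P. y p)"
      have Y: "Y > 0" using y(5) ac(3) True by (simp add: Y_def)
      have "0 \<le> c" using weight[of "\<lambda>_. 0"] by simp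
      define r where "r = (c + 1) / Y"
      have "r \<ge> 0" using Y \<open>0 \<le> c\<close> by (simp add: r_def)
      have "(\<Sum>p\<in>P. r * y p) \<le> c"
      proof (rule weight)
        fix b assume "b \<in> B"
        have "(\<Sum>p\<in>P. r * y p * A p b) = r * (\<Sum>p\<in>P. y p * A p b)" by (simp add: sum_distrib_left mult.assoc)
        also have "\<dots> \<le> r * 0" using load[OF \<open>b \<in> B\<close>] True \<open>r \<ge> 0\<close> by (intro mult_left_mono) auto
        finally show "(\<Sum>p\<in>P. r * y p * A p b) \<le> 1" by simp
      qed (use y \<open>r \<ge> 0\<close> in auto)
      moreover have "(\<Sum>p\<in>P. r * y p) = c + 1"
        unfolding sum_distrib_left [symmetric] using Y by (simp add: r_def flip: Y_def)
      ultimately show False by simp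
    qed
  qed
  moreover have "finite I" using P B by (simp add: I_def)
  ultimately obtain w where "\<forall>(a, c')\<in>I. c' \<le> (\<Sum>j\<in>B. a j * w j)"
    using farkas[OF B, of I] by blast
  then have w: "c' \<le> (\<Sum>j\<in>B. a j * w j)" if "(a, c') \<in> I" for a c'
    using that by auto
  have "0 \<le> w b" if "b \<in> B" for b
  proof -
    have "(\<lambda>j. if j = b then 1 else 0, 0) \<in> I" using that by (simp add: I_def)
    from w[OF this] have "0 \<le> (\<Sum>j\<in>B. if j = b then w j else 0)"
      by (simp add: if_distrib[of "\<lambda>x. x * _"] cong: if_cong)
    thus ?thesis using that B by simp
  qed
  moreover have "(\<Sum>b\<in>B. w b) \<le> c" using w[of "\<lambda>_. -1" "- c"] by (simp add: I_def sum_negf)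
  moreover have "1 \<le> (\<Sum>b\<in>B. A p b * w b)" if "p \<in> P" for p
    using w[of "A p" 1] that by (simp add: I_def)
  ultimately show ?thesis by blast
qed

section \<open>Shifted families and block patterns\<close>

definition shifted :: "nat set set \<Rightarrow> bool" where
  "shifted F \<longleftrightarrow> (\<forall>E\<in>F. \<forall>j\<in>E. \<forall>i. 0 < i \<and> i < j \<and> i \<notin> E \<longrightarrow> insert i (E - {j}) \<in> F)"

text \<open>Move the elements of \<open>E\<close> down one at a time, the smallest one first: its target cannot be
  occupied by an element that still has to move.\<close>

lemma shifted_decrease:
  assumes "shifted F" "E \<in> F" "finite E" "inj_on \<phi> E" "\<And>x. x \<in> E \<Longrightarrow> 0 < \<phi> x \<and> \<phi> x \<le> x"
  shows "\<phi> ` E \<in> F"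
  using assms(2-)
proof (induction "card {x \<in> E. \<phi> x \<noteq> x}" arbitrary: E \<phi>)
  case 0
  then have "\<forall>x\<in>E. \<phi> x = x" by auto
  then have "\<phi> ` E = E" by auto
  thus ?case using 0 by simp
next
  case (Suc m)
  let ?M = "{x \<in> E. \<phi> x \<noteq> x}"
  have ne: "?M \<noteq> {}" using Suc.hyps(2) by (metis card.empty nat.distinct(1))
  have finM: "finite ?M" using Suc.prems(2) by simp
  define x where "x = Min ?M"
  have x: "x \<in> E" "\<phi> x \<noteq> x" using Min_in[OF finM ne] by (auto simp: x_def)
  have least: "x \<le> y" if "y \<in> E" "\<phi> y \<noteq> y" for y using Min_le[OF finM, of y] that by (simp add: x_def)
  have lt: "0 < \<phi> x" "\<phi> x < x" using Suc.prems(4)[OF x(1)] x(2) by auto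
  have notin: "\<phi> x \<notin> E"
  proof
    assume y: "\<phi> x \<in> E"
    then have "\<phi> (\<phi> x) = \<phi> x" using least[OF y] lt by force
    then have "\<phi> x = x" using Suc.prems(3) y x by (auto dest: inj_onD)
    thus False using x by simp
  qed
  let ?E = "insert (\<phi> x) (E - {x})" and ?\<phi> = "\<phi>(\<phi> x := \<phi> x)"
  have E': "?E \<in> F" using assms(1) Suc.prems(1) x lt notin unfolding shifted_def by auto
  have same: "?\<phi> a = \<phi> a" if "a \<in> E - {x}" for a using notin that by auto
  then have im: "?\<phi> ` (E - {x}) = \<phi> ` (E - {x})" by (intro image_cong) auto
  then have "?\<phi> ` ?E = insert (\<phi> x) (\<phi> ` (E - {x}))" by (simp only: image_insert fun_upd_same)
  moreover have "\<phi> ` E = insert (\<phi> x) (\<phi> ` (E - {x}))" using x by blast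
  ultimately have img: "?\<phi> ` ?E = \<phi> ` E" by simp
  have "{z \<in> ?E. ?\<phi> z \<noteq> z} = ?M - {x}" using x notin by auto
  then have cm: "m = card {z \<in> ?E. ?\<phi> z \<noteq> z}" using Suc.hyps(2) x finM by simp
  have inj: "inj_on ?\<phi> ?E"
  proof -
    have "inj_on \<phi> (E - {x})" "\<phi> x \<notin> \<phi> ` (E - {x})"
      using Suc.prems(3) x by (auto simp: inj_on_def)
    moreover have "inj_on ?\<phi> (E - {x}) \<longleftrightarrow> inj_on \<phi> (E - {x})" by (rule inj_on_cong[OF same])
    ultimately show ?thesis using notin by (simp only: inj_on_insert im fun_upd_same) auto
  qed
  have "?\<phi> ` ?E \<in> F"
    by (rule Suc.hyps(1)[OF cm E' _ inj]) (use Suc.prems lt in auto)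
  thus ?case unfolding img .
qed

lemma shifted_transversal:
  assumes "shifted F" "e ` I \<in> F" "finite I" "inj_on e I" "inj_on e' I"
    "\<And>i. i \<in> I \<Longrightarrow> 0 < e' i \<and> e' i \<le> e i"
  shows "e' ` I \<in> F"
proof -
  let ?\<phi> = "e' \<circ> inv_into I e"
  have [simp]: "?\<phi> (e i) = e' i" if "i \<in> I" for i using assms(4) that by simp
  have "?\<phi> ` (e ` I) \<in> F"
  proof (rule shifted_decrease[OF assms(1,2)])
    show "inj_on ?\<phi> (e ` I)"
      using assms(4,5) by (auto simp: inj_on_def)
  qed (use assms in auto)
  moreover have "?\<phi> ` (e ` I) = e' ` I" using assms(4) by (auto simp: image_iff)
  ultimately show ?thesis by simp
qed

definition block :: "nat \<Rightarrow> nat \<Rightarrow> nat set" where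
  "block L b = {b * L<..b * L + L}"

lemma finite_block [simp]: "finite (block L b)" and card_block [simp]: "card (block L b) = L"
  by (simp_all add: block_def)

lemma block_less: "x \<in> block L b \<Longrightarrow> y \<in> block L c \<Longrightarrow> b < c \<Longrightarrow> x < y"
proof -
  assume *: "x \<in> block L b" "y \<in> block L c" "b < c"
  then have "Suc b * L \<le> c * L" by (intro mult_le_mono1) auto
  thus "x < y" using * by (auto simp: block_def)
qed

lemma block_unique: "x \<in> block L b \<Longrightarrow> x \<in> block L c \<Longrightarrow> b = c"
  by (metis block_less less_irrefl nat_neq_iff)

lemma ex_block:
  assumes "0 < x" "x \<le> m * L"
  obtains b where "b < m" "x \<in> block L b"
proof
  have L: "L > 0" using assms by (cases L) auto
  have "(x - 1) div L * L + (x - 1) mod L = x - 1" by (rule div_mult_mod_eq)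
  moreover have "(x - 1) mod L < L" using L by (rule mod_less_divisor)
  ultimately have "(x - 1) div L * L < x" "x \<le> (x - 1) div L * L + L" using assms(1) by linarith+
  thus "x \<in> block L ((x - 1) div L)" by (simp only: block_def greaterThanAtMost_iff)
  have "x - 1 < m * L" using assms by simp
  thus "(x - 1) div L < m" by (simp add: less_mult_imp_div_less)
qed

text \<open>A pattern prescribes the blocks of the vertices of an edge, in some order. Those all of whose
  transversals are edges form a weighted version of the family on \<open>m\<close> points.\<close>

definition full_patterns :: "nat \<Rightarrow> nat \<Rightarrow> nat \<Rightarrow> nat set set \<Rightarrow> (nat \<Rightarrow> nat) set" where
  "full_patterns k m L F = {p \<in> {..<k} \<rightarrow>\<^sub>E {..<m}.
     \<forall>e. inj_on e {..<k} \<longrightarrow> (\<forall>i<k. e i \<in> block L (p i)) \<longrightarrow> e ` {..<k} \<in> F}"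

lemma finite_full_patterns: "finite (full_patterns k m L F)"
  and card_full_patterns: "card (full_patterns k m L F) \<le> m ^ k"
proof -
  have fin: "finite ({..<k} \<rightarrow>\<^sub>E {..<m})" by (simp add: finite_PiE)
  have sub: "full_patterns k m L F \<subseteq> ({..<k} \<rightarrow>\<^sub>E {..<m})" by (auto simp: full_patterns_def)
  show "finite (full_patterns k m L F)" by (rule finite_subset[OF sub fin])
  show "card (full_patterns k m L F) \<le> m ^ k"
    using card_mono[OF fin sub] by (simp add: card_PiE)
qed

text \<open>Rounding: take \<open>\<lfloor>y p L\<rfloor>\<close> disjoint transversals of each pattern \<open>p\<close>. The load condition says
  that no block runs out of vertices, and rounding loses at most one edge per pattern.\<close>

lemma fractional_matching_bound:
  fixes y :: "(nat \<Rightarrow> nat) \<Rightarrow> real" and k m L s :: nat and F :: "nat set set"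
  defines "P \<equiv> full_patterns k m L F"
  assumes k: "0 < k" and F: "matching_at_most s F"
    and y: "\<And>p. 0 \<le> y p"
    and load: "\<And>b. b < m \<Longrightarrow> (\<Sum>p\<in>P. y p * card {i. i < k \<and> p i = b}) \<le> 1"
  shows "L * (\<Sum>p\<in>P. y p) \<le> s + m ^ k"
proof -
  define N where "N p = nat \<lfloor>y p * L\<rfloor>" for p
  have N: "real (N p) \<le> y p * L" "y p * L - 1 \<le> real (N p)" for p
  proof -
    have "0 \<le> y p * L" using y by simp
    then have "real (N p) = of_int \<lfloor>y p * L\<rfloor>" by (simp add: N_def)
    thus "real (N p) \<le> y p * L" "y p * L - 1 \<le> real (N p)" by linarith+
  qed
  have finP: "finite P" by (simp add: P_def finite_full_patterns)
  have Pm: "p i < m" if "p \<in> P" "i < k" for p i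
    using that unfolding P_def full_patterns_def by (auto simp: PiE_iff)
  define J where "J = (SIGMA p:P. {..<N p})"
  have finJ: "finite J" using finP by (simp add: J_def)
  define Q where "Q b = (SIGMA p:P. {..<N p} \<times> {i. i < k \<and> p i = b})" for b
  have finQ: "finite (Q b)" for b using finP by (auto simp: Q_def)
  have "card (Q b) \<le> card (block L b)" if "b < m" for b
  proof -
    have "real (card (Q b)) = (\<Sum>p\<in>P. real (N p) * card {i. i < k \<and> p i = b})"
      unfolding Q_def using finP by (subst card_SigmaI) (auto simp: card_cartesian_product)
    also have "\<dots> \<le> (\<Sum>p\<in>P. (y p * L) * card {i. i < k \<and> p i = b})"
      using N by (intro sum_mono mult_right_mono) auto
    also have "\<dots> = L * (\<Sum>p\<in>P. y p * card {i. i < k \<and> p i = b})"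
      by (simp add: sum_distrib_left algebra_simps)
    also have "\<dots> \<le> real L * 1" using load[OF that] by (intro mult_left_mono) auto
    finally show ?thesis by simp
  qed
  then have "\<exists>g. g ` Q b \<subseteq> block L b \<and> inj_on g (Q b)" if "b < m" for b
    using card_le_inj[OF finQ[of b] finite_block] that by auto
  then obtain g where g: "\<And>b. b < m \<Longrightarrow> g b ` Q b \<subseteq> block L b" "\<And>b. b < m \<Longrightarrow> inj_on (g b) (Q b)"
    by metis
  define h where "h = (\<lambda>(p, c, i). g (p i) (p, c, i))"
  have memQ: "(p, c, i) \<in> Q (p i)" if "(p, c) \<in> J" "i < k" for p c i
    using that by (auto simp: Q_def J_def)
  have hblock: "h (p, c, i) \<in> block L (p i)" if "(p, c) \<in> J" "i < k" for p c i
    using g(1)[OF Pm[of p i]] memQ[OF that] that by (auto simp: h_def J_def)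
  have hinj: "p = p' \<and> c = c' \<and> i = i'"
    if "h (p, c, i) = h (p', c', i')" "(p, c) \<in> J" "(p', c') \<in> J" "i < k" "i' < k" for p c i p' c' i'
  proof -
    have b: "p i = p' i'"
      using block_unique[OF hblock[OF that(2,4)]] hblock[OF that(3,5)] that(1) by simp
    have "p i < m" using that Pm by (auto simp: J_def)
    from inj_onD[OF g(2)[OF this], of "(p, c, i)" "(p', c', i')"] show ?thesis
      using memQ[OF that(2,4)] memQ[OF that(3,5)] that(1) b by (simp add: h_def)
  qed
  define E where "E = (\<lambda>(p, c). (\<lambda>i. h (p, c, i)) ` {..<k})"
  have EF: "E ` J \<subseteq> F"
  proof clarify
    fix p c assume pc: "(p, c) \<in> J"
    then have "p \<in> P" by (simp add: J_def)
    moreover have "inj_on (\<lambda>i. h (p, c, i)) {..<k}"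
    proof (rule inj_onI)
      fix i i' assume "i \<in> {..<k}" "i' \<in> {..<k}" "h (p, c, i) = h (p, c, i')"
      thus "i = i'" using hinj[of p c i p c i'] pc by simp
    qed
    ultimately show "E (p, c) \<in> F" using hblock[OF pc] unfolding E_def P_def full_patterns_def by auto
  qed
  have dis: "E x \<inter> E x' = {}" if "x \<in> J" "x' \<in> J" "x \<noteq> x'" for x x'
  proof (rule ccontr)
    obtain p c p' c' where x: "x = (p, c)" "x' = (p', c')" by (cases x; cases x')
    assume "E x \<inter> E x' \<noteq> {}"
    then obtain i i' where "i < k" "i' < k" "h (p, c, i) = h (p', c', i')" by (auto simp: E_def x)
    thus False using hinj[of p c i p' c' i'] that by (simp add: x)
  qed
  have ne: "E x \<noteq> {}" for x using k by (cases x) (auto simp: E_def)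
  have "inj_on E J" using dis ne by (metis Int_absorb inj_onI)
  moreover have "disjoint (E ` J)"
    unfolding disjoint_def
  proof (intro ballI impI)
    fix A B assume "A \<in> E ` J" "B \<in> E ` J" "A \<noteq> B"
    then obtain x x' where "x \<in> J" "x' \<in> J" "A = E x" "B = E x'" by blast
    thus "A \<inter> B = {}" using dis[of x x'] \<open>A \<noteq> B\<close> by blast
  qed
  ultimately have "card J \<le> s" using matching_at_mostD[OF F EF] by (simp add: card_image)
  have "L * (\<Sum>p\<in>P. y p) - card P = (\<Sum>p\<in>P. y p * L - 1)"
    by (simp add: sum_subtractf sum_distrib_left mult.commute)
  also have "\<dots> \<le> (\<Sum>p\<in>P. real (N p))" using N by (intro sum_mono) auto
  also have "\<dots> = real (card J)" unfolding J_def using finP by (subst card_SigmaI) auto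
  also have "\<dots> \<le> real s" using \<open>card J \<le> s\<close> by simp
  finally have "L * (\<Sum>p\<in>P. y p) - card P \<le> real s" .
  moreover have "real (card P) \<le> real (m ^ k)"
    unfolding P_def using card_full_patterns by (simp only: of_nat_le_iff)
  ultimately show ?thesis unfolding of_nat_add of_nat_power by linarith
qed

text \<open>The dual weighting. Weights can be cut off at \<open>1\<close>, since a pattern using a larger weight is
  covered anyway.\<close>

lemma block_cover_exists:
  assumes "0 < k" "0 < L" "matching_at_most s F"
  shows "\<exists>w::nat \<Rightarrow> real. (\<forall>b. 0 \<le> w b \<and> w b \<le> 1) \<and> (\<Sum>b<m. w b) \<le> (s + m ^ k) / L \<and>
    (\<forall>p\<in>full_patterns k m L F. 1 \<le> (\<Sum>i<k. w (p i)))"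
proof -
  let ?P = "full_patterns k m L F"
  let ?A = "\<lambda>p b. real (card {i. i < k \<and> p i = b})"
  have "\<exists>w. (\<forall>b\<in>{..<m}. 0 \<le> w b) \<and> (\<Sum>b\<in>{..<m}. w b) \<le> (s + m ^ k) / L \<and>
      (\<forall>p\<in>?P. 1 \<le> (\<Sum>b\<in>{..<m}. ?A p b * w b))"
  proof (rule fractional_cover_exists[OF finite_full_patterns finite_lessThan])
    fix y :: "(nat \<Rightarrow> nat) \<Rightarrow> real"
    assume y: "\<And>p. 0 \<le> y p" "\<And>b. b \<in> {..<m} \<Longrightarrow> (\<Sum>p\<in>?P. y p * ?A p b) \<le> 1"
    have "L * (\<Sum>p\<in>?P. y p) \<le> s + m ^ k"
      using y assms by (intro fractional_matching_bound) auto
    thus "(\<Sum>p\<in>?P. y p) \<le> (s + m ^ k) / L" using assms(2) by (simp add: field_simps)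
  qed
  then obtain w where w: "\<And>b. b < m \<Longrightarrow> 0 \<le> w b" "(\<Sum>b<m. w b) \<le> (s + m ^ k) / L"
    "\<And>p. p \<in> ?P \<Longrightarrow> 1 \<le> (\<Sum>b<m. ?A p b * w b)" by auto
  define w' where "w' b = (if b < m then min 1 (w b) else 0)" for b
  have "(\<Sum>b<m. w' b) \<le> (\<Sum>b<m. w b)" by (intro sum_mono) (auto simp: w'_def)
  moreover have "1 \<le> (\<Sum>i<k. w' (p i))" if p: "p \<in> ?P" for p
  proof -
    have pm: "p i < m" if "i < k" for i using p that by (auto simp: full_patterns_def PiE_iff)
    have nn: "0 \<le> w' b" for b using w(1) by (auto simp: w'_def)
    show ?thesis
    proof (cases "\<exists>i<k. 1 < w (p i)")
      case True
      then obtain i where i: "i < k" "1 < w (p i)" by auto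
      then have "1 = w' (p i)" using pm by (simp add: w'_def)
      also have "\<dots> \<le> (\<Sum>i<k. w' (p i))" using i nn by (intro member_le_sum) auto
      finally show ?thesis .
    next
      case False
      have "(\<Sum>b<m. ?A p b * w b) = (\<Sum>b<m. \<Sum>i\<in>{i. i < k \<and> p i = b}. w (p i))"
        by (intro sum.cong) auto
      also have "\<dots> = (\<Sum>b<m. \<Sum>i\<in>{i \<in> {..<k}. p i = b}. w (p i))"
        by (intro sum.cong) auto
      also have "\<dots> = (\<Sum>i<k. w (p i))" using pm by (intro sum.group) auto
      also have "\<dots> = (\<Sum>i<k. w' (p i))" using False pm by (intro sum.cong) (auto simp: w'_def)
      finally show ?thesis using w(3)[OF p] by simp
    qed
  qed
  ultimately show ?thesis using w(1,2) by (intro exI[of _ w']) (auto simp: w'_def)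
qed

text \<open>Lowering every vertex by one block turns an edge into a transversal dominated by it, so the
  lowered pattern of an edge avoiding the first block is full.\<close>

lemma lowered_pattern_full:
  assumes "shifted F" "e ` {..<k} \<in> F" "inj_on e {..<k}" "p \<in> {..<k} \<rightarrow>\<^sub>E {..<m}"
    "\<And>i. i < k \<Longrightarrow> e i \<in> block L (Suc (p i))"
  shows "p \<in> full_patterns k m L F"
  unfolding full_patterns_def
proof (intro CollectI conjI allI impI assms(4))
  fix e' assume e': "inj_on e' {..<k}" "\<forall>i<k. e' i \<in> block L (p i)"
  show "e' ` {..<k} \<in> F"
  proof (rule shifted_transversal[OF assms(1,2) _ assms(3) e'(1)])
    fix i assume "i \<in> {..<k}"
    then have "e' i \<in> block L (p i)" "e i \<in> block L (Suc (p i))" using e' assms(5) by auto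
    thus "0 < e' i \<and> e' i \<le> e i" by (auto simp: block_def)
  qed simp
qed

text \<open>The vertices that cannot be lowered by one block, together with those that lie in no block.\<close>

definition margin :: "nat \<Rightarrow> nat \<Rightarrow> nat \<Rightarrow> nat set" where
  "margin m L n = block L 0 \<union> {m * L<..n}"

lemma not_margin:
  assumes "x \<in> {1..n}" "x \<notin> margin m L n"
  obtains b where "Suc b < m" "x \<in> block L (Suc b)"
proof -
  have "0 < x" "x \<le> m * L" using assms by (auto simp: margin_def)
  then obtain b where b: "b < m" "x \<in> block L b" by (rule ex_block)
  have "b \<noteq> 0" using b assms by (auto simp: margin_def intro: ccontr)
  thus thesis using b that by (cases b) auto
qed

lemma edge_lowered_pattern:
  assumes "shifted F" "F \<subseteq> nsets {1..n} k" "E \<in> F" "E \<inter> margin m L n = {}"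
    and e: "inj_on e {..<k}" "e ` {..<k} = E"
  obtains p where "p \<in> full_patterns k m L F" "\<And>i. i < k \<Longrightarrow> Suc (p i) < m" "\<And>i. i < k \<Longrightarrow> e i \<in> block L (Suc (p i))"
proof -
  have "\<exists>b. Suc b < m \<and> e i \<in> block L (Suc b)" if "i < k" for i
  proof -
    have "e i \<in> E" using e that by auto
    moreover have "E \<subseteq> {1..n}" using assms(2,3) nsetsD by blast
    ultimately have "e i \<in> {1..n}" "e i \<notin> margin m L n" using assms(4) by blast+
    thus ?thesis by (metis not_margin)
  qed
  then obtain q where q: "\<And>i. i < k \<Longrightarrow> Suc (q i) < m \<and> e i \<in> block L (Suc (q i))" by metis
  let ?p = "restrict q {..<k}"
  have "?p \<in> full_patterns k m L F"
  proof (rule lowered_pattern_full[OF assms(1) _ e(1)])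
    show "?p \<in> {..<k} \<rightarrow>\<^sub>E {..<m}" using q by (auto intro: Suc_lessD)
  qed (use assms(3) e(2) q in auto)
  thus thesis using that[of ?p] q by simp
qed

text \<open>Covering \<open>F\<close>: some vertex of an edge lies one block above a block of weight at least \<open>1 / k\<close>.\<close>

lemma shifted_cover:
  fixes w :: "nat \<Rightarrow> real"
  assumes k: "0 < k" and "shifted F" "F \<subseteq> nsets {1..n} k" "m * L \<le> n"
    and w: "\<And>p. p \<in> full_patterns k m L F \<Longrightarrow> 1 \<le> (\<Sum>i<k. w (p i))"
  shows "\<exists>T\<subseteq>{1..n}. (\<forall>E\<in>F. E \<inter> T \<noteq> {}) \<and>
    card T \<le> L + (n - m * L) + L * card {b. b < m \<and> 1 / k \<le> w b}"
proof -
  let ?B = "{b. Suc b < m \<and> 1 / k \<le> w b}"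
  let ?U = "\<Union>b\<in>?B. block L (Suc b)"
  let ?T = "(margin m L n \<union> ?U) \<inter> {1..n}"
  have finB: "finite ?B" by (rule finite_subset[of _ "{..<m}"]) auto
  have "E \<inter> ?T \<noteq> {}" if E: "E \<in> F" for E
  proof
    assume *: "E \<inter> ?T = {}"
    have E': "E \<subseteq> {1..n}" "finite E" "card E = k" using E assms(3) by (auto simp: nsets_def)
    then obtain e where e: "bij_betw e {..<k} E"
      using ex_bij_betw_nat_finite[of E] by (auto simp: atLeast0LessThan)
    have "E \<inter> margin m L n = {}" using * E' by auto
    then obtain p where p: "p \<in> full_patterns k m L F" "\<And>i. i < k \<Longrightarrow> Suc (p i) < m"
      "\<And>i. i < k \<Longrightarrow> e i \<in> block L (Suc (p i))"
      using edge_lowered_pattern[OF assms(2,3) E] e unfolding bij_betw_def by metis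
    have "w (p i) < 1 / k" if "i < k" for i
    proof (rule ccontr)
      assume "\<not> w (p i) < 1 / k"
      then have "e i \<in> ?U" using p(2,3)[OF that] by auto
      moreover have "e i \<in> E" using e that by (auto simp: bij_betw_def)
      ultimately show False using * E' by auto
    qed
    then have "(\<Sum>i<k. w (p i)) < (\<Sum>i<k. 1 / k)" using k by (intro sum_strict_mono) auto
    thus False using w[OF p(1)] k by simp
  qed
  moreover have "card ?T \<le> L + (n - m * L) + L * card {b. b < m \<and> 1 / k \<le> w b}"
  proof -
    have "card ?T \<le> card (margin m L n \<union> ?U)" using finB by (intro card_mono) (auto simp: margin_def)
    also have "\<dots> \<le> card (block L 0) + card {m * L<..n} + card ?U"
      unfolding margin_def by (meson add_le_mono1 card_Un_le le_trans)
    also have "card ?U \<le> (\<Sum>b\<in>?B. card (block L (Suc b)))" by (rule card_UN_le[OF finB])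
    also have "\<dots> = L * card ?B" by simp
    also have "\<dots> \<le> L * card {b. b < m \<and> 1 / k \<le> w b}"
      by (intro mult_left_mono card_mono) auto
    finally show ?thesis by simp
  qed
  ultimately show ?thesis by (intro exI[of _ ?T]) auto
qed

text \<open>Each edge outside the margin has \<open>k!\<close> orderings, each of which is a transversal of a lowered
  full pattern.\<close>

lemma card_shifted_le:
  assumes "shifted F" "F \<subseteq> nsets {1..n} k" "0 < k" "m * L \<le> n"
  shows "fact k * card F \<le> card (full_patterns k m L F) * L ^ k + fact k * ((L + (n - m * L)) * n ^ (k - 1))"
proof -
  let ?P = "full_patterns k m L F"
  define F0 where "F0 = {E \<in> F. E \<inter> margin m L n = {}}"
  define F1 where "F1 = {E \<in> F. E \<inter> margin m L n \<noteq> {}}"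
  have finF: "finite F" using assms(2) finite_imp_finite_nsets[of "{1..n}"] finite_subset by blast
  have "F = F0 \<union> F1" by (auto simp: F0_def F1_def)
  then have split: "card F \<le> card F0 + card F1" using card_Un_le[of F0 F1] by simp
  have "F1 \<subseteq> (\<lambda>(x, D). insert x D) ` (margin m L n \<times> nsets {1..n} (k - 1))"
  proof
    fix E assume "E \<in> F1"
    then obtain x where x: "x \<in> E" "x \<in> margin m L n" "E \<in> nsets {1..n} k" using assms(2) by (auto simp: F1_def)
    then have "E - {x} \<in> nsets {1..n} (k - 1)" "insert x (E - {x}) = E" by (auto simp: nsets_def)
    thus "E \<in> (\<lambda>(x, D). insert x D) ` (margin m L n \<times> nsets {1..n} (k - 1))"
      using x by (intro image_eqI[of _ _ "(x, E - {x})"]) auto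
  qed
  then have "card F1 \<le> card (margin m L n \<times> nsets {1..n} (k - 1))"
    by (intro surj_card_le) (auto simp: finite_imp_finite_nsets margin_def)
  also have "\<dots> \<le> (L + (n - m * L)) * n ^ (k - 1)"
    unfolding card_cartesian_product margin_def
    using card_Un_le[of "block L 0" "{m * L<..n}"] binomial_le_power[of n "k - 1"]
    by (intro mult_mono) auto
  finally have F1: "card F1 \<le> (L + (n - m * L)) * n ^ (k - 1)" .
  have "\<exists>e. bij_betw e {..<k} E" if "E \<in> F0" for E
    using that assms(2) ex_bij_betw_nat_finite[of E] by (auto simp: F0_def nsets_def atLeast0LessThan)
  then obtain en where en: "\<And>E. E \<in> F0 \<Longrightarrow> bij_betw (en E) {..<k} E" by metis
  define Q where "Q = {\<pi>. \<pi> permutes {..<k}}"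
  define ord where "ord = (\<lambda>(E, \<pi>). restrict (en E \<circ> \<pi>) {..<k})"
  have ord: "inj_on (ord (E, \<pi>)) {..<k}" "ord (E, \<pi>) ` {..<k} = E" if "E \<in> F0" "\<pi> \<in> Q" for E \<pi>
  proof -
    have "bij_betw (en E \<circ> \<pi>) {..<k} E"
      using en[OF that(1)] that(2) permutes_imp_bij by (auto simp: Q_def intro: bij_betw_trans)
    then show "inj_on (ord (E, \<pi>)) {..<k}" "ord (E, \<pi>) ` {..<k} = E"
      by (auto simp: ord_def bij_betw_def inj_on_def)
  qed
  have "inj_on ord (F0 \<times> Q)"
  proof (rule inj_onI, clarify)
    fix E \<pi> E' \<pi>' assume a: "E \<in> F0" "\<pi> \<in> Q" "E' \<in> F0" "\<pi>' \<in> Q" "ord (E, \<pi>) = ord (E', \<pi>')"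
    then have [simp]: "E' = E" using ord(2) by metis
    have "\<pi> i = \<pi>' i" for i
    proof (cases "i < k")
      case True
      then have "en E (\<pi> i) = en E (\<pi>' i)" using a(5) by (auto simp: ord_def dest: fun_cong[of _ _ i])
      moreover have "\<pi> i < k" "\<pi>' i < k"
        using a(2,4) True permutes_in_image[of \<pi> "{..<k}"] permutes_in_image[of \<pi>' "{..<k}"] by (auto simp: Q_def)
      ultimately show ?thesis using en[OF a(1)] by (auto simp: bij_betw_def dest: inj_onD)
    next
      case False
      thus ?thesis using a(2,4) by (auto simp: Q_def permutes_def)
    qed
    thus "E = E' \<and> \<pi> = \<pi>'" by auto
  qed
  moreover have "ord ` (F0 \<times> Q) \<subseteq> (\<Union>p\<in>?P. PiE {..<k} (\<lambda>i. block L (Suc (p i))))"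
  proof clarify
    fix E \<pi> assume a: "E \<in> F0" "\<pi> \<in> Q"
    have E: "E \<in> F" "E \<inter> margin m L n = {}" using a(1) by (auto simp: F0_def)
    obtain p where p: "p \<in> ?P" "\<And>i. i < k \<Longrightarrow> ord (E, \<pi>) i \<in> block L (Suc (p i))"
      by (rule edge_lowered_pattern[OF assms(1,2) E ord[OF a]]) (rule that)
    moreover have "ord (E, \<pi>) \<in> extensional {..<k}" by (simp add: ord_def)
    ultimately show "ord (E, \<pi>) \<in> (\<Union>p\<in>?P. PiE {..<k} (\<lambda>i. block L (Suc (p i))))"
      by (auto simp: PiE_iff)
  qed
  ultimately have "card (F0 \<times> Q) \<le> card (\<Union>p\<in>?P. PiE {..<k} (\<lambda>i. block L (Suc (p i))))"
    by (intro card_inj_on_le) (auto simp: finite_full_patterns intro!: finite_PiE)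
  also have "\<dots> \<le> (\<Sum>p\<in>?P. card (PiE {..<k} (\<lambda>i. block L (Suc (p i)))))"
    by (rule card_UN_le[OF finite_full_patterns])
  also have "\<dots> = card ?P * L ^ k" by (simp add: card_PiE)
  finally have "fact k * card F0 \<le> card ?P * L ^ k"
    by (simp add: card_cartesian_product Q_def card_permutations mult.commute)
  moreover have "fact k * card F \<le> fact k * card F0 + fact k * card F1"
    using split by (metis add_mult_distrib2 mult_le_mono2)
  moreover have "fact k * card F1 \<le> fact k * ((L + (n - m * L)) * n ^ (k - 1))"
    using F1 by (rule mult_le_mono2)
  ultimately show ?thesis by linarith
qed

section \<open>Stability of the tail bound\<close>

text \<open>Portmanteau for closed sets: approximate the indicator from above by continuous functions.\<close>

lemma weak_conv_closed_le:
  fixes C :: "real set"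
  assumes \<mu>: "\<And>n. real_distribution (\<mu> n)" and M: "real_distribution M" and conv: "weak_conv_m \<mu> M"
    and C: "closed C" "C \<noteq> {}" and b: "b \<longlonglongrightarrow> \<beta>" "\<And>n. b n \<le> measure (\<mu> n) C"
  shows "\<beta> \<le> measure M C"
proof -
  interpret M: real_distribution M by fact
  interpret \<mu>: real_distribution "\<mu> n" for n by fact
  define g where "g N x = max 0 (1 - real N * infdist x C)" for N :: nat and x :: real
  have cont: "isCont (g N) x" for N x
    unfolding g_def by (intro continuous_intros)
  have bd: "norm (g N x) \<le> 1" for N x using infdist_nonneg[of x C] by (auto simp: g_def)
  have meas: "g N \<in> borel_measurable borel" for N
    using cont by (intro borel_measurable_continuous_onI continuous_at_imp_continuous_on) auto
  have Cm: "C \<in> sets borel" using C by simp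
  have ge: "indicator C x \<le> g N x" for N x by (auto simp: g_def indicator_def)
  have le: "\<beta> \<le> integral\<^sup>L M (g N)" for N
  proof (rule LIMSEQ_le[OF b(1)])
    show "(\<lambda>n. integral\<^sup>L (\<mu> n) (g N)) \<longlonglongrightarrow> integral\<^sup>L M (g N)"
      using weak_conv_imp_integral_bdd_continuous_conv[OF \<mu> M conv cont bd] .
    have "b n \<le> integral\<^sup>L (\<mu> n) (g N)" for n
    proof -
      have "measure (\<mu> n) C = integral\<^sup>L (\<mu> n) (indicator C)" using Cm by simp
      also have "\<dots> \<le> integral\<^sup>L (\<mu> n) (g N)"
      proof (rule integral_mono)
        show "integrable (\<mu> n) (g N)"
          by (rule \<mu>.integrable_const_bound[where B = 1]) (use bd meas in auto)
        show "integrable (\<mu> n) (indicator C :: real \<Rightarrow> real)"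
          by (rule \<mu>.integrable_const_bound[where B = 1]) (use Cm in \<open>auto simp: indicator_def\<close>)
      qed (use ge in auto)
      finally show ?thesis using b(2)[of n] by simp
    qed
    thus "\<exists>N0. \<forall>n\<ge>N0. b n \<le> integral\<^sup>L (\<mu> n) (g N)" by blast
  qed
  have "(\<lambda>N. integral\<^sup>L M (g N)) \<longlonglongrightarrow> integral\<^sup>L M (indicator C)"
  proof (rule integral_dominated_convergence[where w = "\<lambda>_. 1"])
    show "AE x in M. (\<lambda>N. g N x) \<longlonglongrightarrow> indicator C x"
    proof (rule AE_I2)
      fix x
      show "(\<lambda>N. g N x) \<longlonglongrightarrow> indicator C x"
      proof (cases "x \<in> C")
        case True
        thus ?thesis by (simp add: g_def)
      next
        case False
        then have "infdist x C > 0" using infdist_pos_not_in_closed[OF C False] by simp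
        then obtain N0 :: nat where N0: "1 < N0 * infdist x C" using reals_Archimedean3 by blast
        have "g N x = 0" if "N \<ge> N0" for N
        proof -
          have "N0 * infdist x C \<le> N * infdist x C" using that infdist_nonneg by (intro mult_right_mono) auto
          thus ?thesis using N0 by (simp add: g_def)
        qed
        then have "(\<lambda>N. g N x) \<longlonglongrightarrow> 0"
          by (intro tendsto_eventually) (auto simp: eventually_sequentially)
        thus ?thesis using False by simp
      qed
    qed
  qed (use meas bd Cm in auto)
  then have "\<beta> \<le> integral\<^sup>L M (indicator C)" by (rule LIMSEQ_le_const) (use le in auto)
  thus ?thesis using Cm by simp
qed

definition uniform_law :: "'a set \<Rightarrow> ('a \<Rightarrow> real) \<Rightarrow> real measure" where
  "uniform_law S f = distr (measure_pmf (pmf_of_set S)) borel f"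

lemma real_distribution_uniform_law: "real_distribution (uniform_law S f)"
  unfolding uniform_law_def
  by (intro prob_space.real_distribution_distr prob_space_measure_pmf) simp

lemma measure_uniform_law:
  assumes "finite S" "S \<noteq> {}" "A \<in> sets borel"
  shows "measure (uniform_law S f) A = card {s \<in> S. f s \<in> A} / card S"
proof -
  have "S \<inter> f -` A = {s \<in> S. f s \<in> A}" by auto
  thus ?thesis unfolding uniform_law_def using assms by (simp add: measure_distr measure_pmf_of_set)
qed

lemma integral_uniform_law:
  fixes h :: "real \<Rightarrow> 'b :: {banach, second_countable_topology}"
  assumes "finite S" "S \<noteq> {}" "h \<in> borel_measurable borel"
  shows "integral\<^sup>L (uniform_law S f) h = (\<Sum>s\<in>S. h (f s)) /\<^sub>R card S"
proof -
  have "integral\<^sup>L (uniform_law S f) h = (\<Sum>s\<in>S. pmf (pmf_of_set S) s *\<^sub>R h (f s))"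
    unfolding uniform_law_def using assms integral_measure_pmf[OF assms(1), of "pmf_of_set S" "\<lambda>s. h (f s)"]
    by (subst integral_distr) auto
  also have "\<dots> = (\<Sum>s\<in>S. h (f s)) /\<^sub>R card S"
    using assms by (simp add: scaleR_sum_right divide_inverse)
  finally show ?thesis .
qed

text \<open>Choosing a uniform tuple amounts to choosing its entries independently.\<close>

lemma char_uniform_law_sum:
  assumes "finite S" "S \<noteq> {}"
  shows "char (uniform_law ({..<k} \<rightarrow>\<^sub>E S) (\<lambda>p. \<Sum>i<k. f (p i))) t = char (uniform_law S f) t ^ k"
proof -
  let ?T = "{..<k::nat} \<rightarrow>\<^sub>E S"
  have T: "finite ?T" "?T \<noteq> {}" using assms by (auto simp: finite_PiE PiE_eq_empty_iff)
  have "char (uniform_law ?T (\<lambda>p. \<Sum>i<k. f (p i))) t = (\<Sum>p\<in>?T. iexp (t * (\<Sum>i<k. f (p i)))) /\<^sub>R card ?T"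
    unfolding char_def using T by (subst integral_uniform_law) auto
  also have "(\<Sum>p\<in>?T. iexp (t * (\<Sum>i<k. f (p i)))) = (\<Sum>p\<in>?T. \<Prod>i<k. iexp (t * f (p i)))"
    by (intro sum.cong refl) (simp add: sum_distrib_left exp_sum)
  also have "\<dots> = (\<Prod>i<k. \<Sum>b\<in>S. iexp (t * f b))"
    using assms by (subst prod_sum_PiE) auto
  also have "card ?T = card S ^ k" by (simp add: card_PiE)
  also have "(\<Prod>i<k. \<Sum>b\<in>S. iexp (t * f b)) /\<^sub>R real (card S ^ k) = ((\<Sum>b\<in>S. iexp (t * f b)) /\<^sub>R card S) ^ k"
    by (simp add: scaleR_power power_inverse)
  also have "(\<Sum>b\<in>S. iexp (t * f b)) /\<^sub>R card S = char (uniform_law S f) t"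
    unfolding char_def using assms by (subst integral_uniform_law) auto
  finally show ?thesis .
qed

text \<open>Every law on the unit interval is the law of independent random variables with values in the
  unit interval; the coordinates of the product space are truncated so that this holds everywhere.\<close>

lemma iid_unit_interval_exists:
  assumes L: "real_distribution L" "AE x in L. x \<in> {0..1}" "integral\<^sup>L L (\<lambda>x. max 0 (min 1 x)) \<le> x" and "0 < k"
  shows "\<exists>(M :: (nat \<Rightarrow> real) measure) Z. iid_unit_interval M k x Z \<and> (\<forall>i\<in>{1..k}. distr M borel (Z i) = L)"
proof -
  interpret L: real_distribution L by fact
  let ?I = "{1..k}"
  let ?c = "\<lambda>x::real. max 0 (min 1 x)"
  define N where "N = (\<Pi>\<^sub>M i\<in>?I. L)"
  define Z where "Z i \<omega> = ?c (\<omega> i)" for i :: nat and \<omega> :: "nat \<Rightarrow> real"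
  interpret N: prob_space N unfolding N_def by (intro prob_space_PiM) (rule L.prob_space_axioms)
  have setsN: "sets N = sets (\<Pi>\<^sub>M i\<in>?I. borel)" unfolding N_def by (intro sets_PiM_cong) auto
  have coord: "(\<lambda>\<omega>. \<omega> i) \<in> borel_measurable N" if "i \<in> ?I" for i
    using that by (subst measurable_cong_sets[OF setsN refl]) simp
  have law: "distr N borel (\<lambda>\<omega>. \<omega> i) = L" if "i \<in> ?I" for i
  proof -
    have "distr N borel (\<lambda>\<omega>. \<omega> i) = distr N L (\<lambda>\<omega>. \<omega> i)" by (rule distr_cong) auto
    also have "\<dots> = L" unfolding N_def using that by (intro distr_PiM_component) (auto intro: L.prob_space_axioms)
    finally show ?thesis .
  qed
  have "N.indep_vars (\<lambda>_. borel) (\<lambda>i \<omega>. \<omega> i) ?I"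
  proof (subst N.indep_vars_iff_distr_eq_PiM')
    have "distr N (\<Pi>\<^sub>M i\<in>?I. borel) (\<lambda>\<omega>. \<lambda>i\<in>?I. \<omega> i) = distr N N (\<lambda>\<omega>. \<omega>)"
    proof (rule distr_cong)
      fix \<omega> assume "\<omega> \<in> space N"
      then have "\<omega> \<in> extensional ?I" by (auto simp: N_def space_PiM PiE_iff)
      thus "(\<lambda>i\<in>?I. \<omega> i) = \<omega>" by (rule extensional_restrict)
    qed (use setsN in auto)
    also have "\<dots> = N" by simp
    also have "N = (\<Pi>\<^sub>M i\<in>?I. distr N borel (\<lambda>\<omega>. \<omega> i))"
      by (subst (1) N_def) (intro PiM_cong refl law[symmetric])
    finally show "distr N (\<Pi>\<^sub>M i\<in>?I. borel) (\<lambda>\<omega>. \<lambda>i\<in>?I. \<omega> i) = (\<Pi>\<^sub>M i\<in>?I. distr N borel (\<lambda>\<omega>. \<omega> i))" .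
  qed (use assms coord in auto)
  then have indep: "N.indep_vars (\<lambda>_. borel) Z ?I"
    unfolding Z_def by (rule N.indep_vars_compose2) simp
  have Zlaw: "distr N borel (Z i) = L" if i: "i \<in> ?I" for i
  proof -
    have "distr N borel (Z i) = distr (distr N borel (\<lambda>\<omega>. \<omega> i)) borel ?c"
      using coord[OF i] by (subst distr_distr) (auto simp: Z_def[abs_def] comp_def)
    also have "\<dots> = distr L borel ?c" unfolding law[OF i] ..
    also have "\<dots> = distr L borel (\<lambda>x. x)"
    proof (rule distr_cong_AE)
      show "AE x in L. ?c x = x" using L(2) by eventually_elim auto
    qed auto
    also have "\<dots> = distr L L (\<lambda>x. x)" by (rule distr_cong) auto
    also have "\<dots> = L" by simp
    finally show ?thesis .
  qed
  have "N.expectation (Z i) \<le> x" if i: "i \<in> ?I" for i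
  proof -
    have "N.expectation (Z i) = integral\<^sup>L (distr N borel (\<lambda>\<omega>. \<omega> i)) ?c"
      using coord[OF i] by (subst integral_distr) (auto simp: Z_def[abs_def])
    thus ?thesis unfolding law[OF i] using L(3) by simp
  qed
  then have "iid_unit_interval N k x Z"
    unfolding iid_unit_interval_def using indep Zlaw N.prob_space_axioms by (auto simp: Z_def)
  thus ?thesis using Zlaw by blast
qed

lemma measure_two_point_law:
  assumes "0 \<le> x" "x \<le> 1" "0 < c" "c \<le> 1"
  shows "measure (two_point_law x) {c..} = x"
proof -
  have "emeasure (two_point_law x) {c..} = ennreal x"
    using assms by (subst emeasure_two_point_law) auto
  thus ?thesis using assms by (simp add: measure_def)
qed

text \<open>A near-extremal law puts little more than mass \<open>x\<close> on \<open>[1 / k, 1]\<close>. Otherwise, near-extremal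
  laws violating this would have a weak limit; by the continuity theorem the laws of the \<open>k\<close>-fold sums
  converge as well, so the limit is extremal for the tail bound, hence equal to \<open>\<mu>\<^sub>x\<close>, and passing to
  the limit in the violated inequality gives a contradiction.\<close>

lemma tail_bound_stability:
  fixes a u \<eta> :: real
  assumes k: "0 < k" and tb: "\<And>x. 0 < x \<Longrightarrow> x \<le> u \<Longrightarrow> tail_bound k x"
    and a: "0 < a" and u: "u \<le> 1" and \<eta>: "0 < \<eta>"
  shows "\<exists>\<epsilon>>0. \<forall>x m (w :: nat \<Rightarrow> real). a \<le> x \<and> x \<le> u \<and> 0 < m \<and> (\<forall>b. 0 \<le> w b \<and> w b \<le> 1) \<and>
      (\<Sum>b<m. w b) \<le> (x + \<epsilon>) * m \<and>
      (q_fun k x - \<epsilon>) * real m ^ k \<le> card {p \<in> {..<k} \<rightarrow>\<^sub>E {..<m}. 1 \<le> (\<Sum>i<k. w (p i))} \<longrightarrow>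
      card {b. b < m \<and> 1 / k \<le> w b} \<le> (x + \<eta>) * m"
proof (rule ccontr)
  define H where "H \<epsilon> x m w \<longleftrightarrow> a \<le> x \<and> x \<le> u \<and> 0 < m \<and> (\<forall>b. 0 \<le> w b \<and> w b \<le> 1) \<and>
      (\<Sum>b<m. w b) \<le> (x + \<epsilon>) * m \<and>
      (q_fun k x - \<epsilon>) * real m ^ k \<le> card {p \<in> {..<k} \<rightarrow>\<^sub>E {..<m}. 1 \<le> (\<Sum>i<k. w (p i))}"
    for \<epsilon> x :: real and m :: nat and w :: "nat \<Rightarrow> real"
  define C where "C x m w \<longleftrightarrow> card {b. b < m \<and> 1 / k \<le> w b} \<le> (x + \<eta>) * m"
    for x :: real and m :: nat and w :: "nat \<Rightarrow> real"
  assume "\<not> ?thesis"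
  then have "\<not> (\<exists>\<epsilon>>0. \<forall>x m w. H \<epsilon> x m w \<longrightarrow> C x m w)" unfolding H_def C_def .
  then have "\<exists>x m w. H (1 / (real j + 1)) x m w \<and> \<not> C x m w" for j :: nat
    by (metis add_nonneg_pos of_nat_0_le_iff zero_less_divide_1_iff zero_less_one)
  then obtain X m w where "\<And>j :: nat. H (1 / (real j + 1)) (X j) (m j) (w j) \<and> \<not> C (X j) (m j) (w j)" by metis
  then have bad: "a \<le> X j" "X j \<le> u" "0 < m j" "0 \<le> w j b" "w j b \<le> 1"
      "(\<Sum>b<m j. w j b) \<le> (X j + 1 / (real j + 1)) * m j"
      "(q_fun k (X j) - 1 / (real j + 1)) * m j ^ k \<le> card {p \<in> {..<k} \<rightarrow>\<^sub>E {..<m j}. 1 \<le> (\<Sum>i<k. w j (p i))}"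
      "(X j + \<eta>) * m j < card {b. b < m j \<and> 1 / k \<le> w j b}" for j b
    unfolding H_def C_def by (auto simp: not_le)
  define D where "D j = uniform_law {..<m j} (w j)" for j
  define S where "S j = uniform_law ({..<k} \<rightarrow>\<^sub>E {..<m j}) (\<lambda>p. \<Sum>i<k. w j (p i))" for j
  have ne: "{..<m j} \<noteq> {}" "({..<k} \<rightarrow>\<^sub>E {..<m j}) \<noteq> {}" "finite ({..<k} \<rightarrow>\<^sub>E {..<m j})" for j
    using bad(3)[of j] by (auto simp: PiE_eq_empty_iff finite_PiE lessThan_empty_iff)
  have rdD: "real_distribution (D j)" and rdS: "real_distribution (S j)" for j
    unfolding D_def S_def by (rule real_distribution_uniform_law)+
  have D_unit: "measure (D j) A = 1" if "A \<in> sets borel" "{0..1} \<subseteq> A" for j A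
  proof -
    have "{s \<in> {..<m j}. w j s \<in> A} = {..<m j}" using bad(4,5) that by auto
    thus ?thesis using that(1) ne(1)[of j] bad(3)[of j] by (simp add: D_def measure_uniform_law)
  qed
  have "tight D"
    unfolding tight_def
  proof (intro conjI allI impI rdD)
    fix \<epsilon> :: real assume "0 < \<epsilon>"
    thus "\<exists>a b. a < b \<and> (\<forall>n. 1 - \<epsilon> < measure (D n) {a<..b})"
      by - (rule exI[of _ "-1"], rule exI[of _ 1], simp add: D_unit subset_iff)
  qed
  have "X j \<in> {a..u}" for j using bad(1,2) by auto
  then obtain x r1 where x: "x \<in> {a..u}" "strict_mono r1" "(X \<circ> r1) \<longlonglongrightarrow> x"
    using compact_Icc[of a u, unfolded compact_eq_seq_compact_metric seq_compact_def] by metis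
  from tight_imp_convergent_subsubsequence[OF \<open>tight D\<close> x(2)]
  obtain r L where r: "strict_mono r" and L: "real_distribution L" and convL: "weak_conv_m (D \<circ> r1 \<circ> r) L" by blast
  define \<sigma> where "\<sigma> = r1 \<circ> r"
  have \<sigma>: "strict_mono \<sigma>" using x(2) r by (simp add: \<sigma>_def strict_mono_o)
  have convD: "weak_conv_m (\<lambda>j. D (\<sigma> j)) L" using convL by (simp add: \<sigma>_def comp_def)
  have convX: "(\<lambda>j. X (\<sigma> j)) \<longlonglongrightarrow> x"
    using LIMSEQ_subseq_LIMSEQ[OF x(3) r] by (simp add: \<sigma>_def comp_def)
  have conv0: "(\<lambda>j. 1 / (real (\<sigma> j) + 1)) \<longlonglongrightarrow> 0"
    using LIMSEQ_subseq_LIMSEQ[OF LIMSEQ_inverse_real_of_nat \<sigma>] by (simp add: comp_def inverse_eq_divide add.commute)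
  interpret L: real_distribution L by fact
  have "1 \<le> measure L {0..1}"
    by (rule weak_conv_closed_le[OF rdD L convD _ _ tendsto_const]) (auto simp: D_unit)
  then have unit: "AE x in L. x \<in> {0..1}"
    by (intro L.AE_prob_1) (simp add: antisym)
  let ?c = "\<lambda>x::real. max 0 (min 1 x)"
  have "integral\<^sup>L L ?c \<le> x"
  proof (rule LIMSEQ_le)
    show "(\<lambda>j. integral\<^sup>L (D (\<sigma> j)) ?c) \<longlonglongrightarrow> integral\<^sup>L L ?c"
      by (rule weak_conv_imp_integral_bdd_continuous_conv[OF rdD L convD, where B = 1])
        (auto intro!: continuous_intros)
    show "(\<lambda>j. X (\<sigma> j) + 1 / (real (\<sigma> j) + 1)) \<longlonglongrightarrow> x" using tendsto_add[OF convX conv0] by simp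
    have "integral\<^sup>L (D j) ?c \<le> X j + 1 / (real j + 1)" for j
    proof -
      have "integral\<^sup>L (D j) ?c = (\<Sum>b<m j. ?c (w j b)) / m j"
        unfolding D_def using ne(1)[of j] by (subst integral_uniform_law) (auto simp: divide_inverse_commute)
      also have "(\<Sum>b<m j. ?c (w j b)) = (\<Sum>b<m j. w j b)" using bad(4,5) by (intro sum.cong) auto
      also have "\<dots> / m j \<le> X j + 1 / (real j + 1)" using bad(3,6)[of j] by (simp add: field_simps)
      finally show ?thesis .
    qed
    thus "\<exists>N. \<forall>n\<ge>N. integral\<^sup>L (D (\<sigma> n)) ?c \<le> X (\<sigma> n) + 1 / (real (\<sigma> n) + 1)" by blast
  qed
  from iid_unit_interval_exists[OF L unit this k] obtain M :: "(nat \<Rightarrow> real) measure" and Z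
    where iid: "iid_unit_interval M k x Z" and Z: "\<And>i. i \<in> {1..k} \<Longrightarrow> distr M borel (Z i) = L" by blast
  interpret M: prob_space M using iid by (simp add: iid_unit_interval_def)
  have indep: "M.indep_vars (\<lambda>_. borel) Z {1..k}" using iid by (simp add: iid_unit_interval_def)
  let ?\<Sigma> = "\<lambda>\<omega>. \<Sum>i=1..k. Z i \<omega>"
  define S' where "S' = distr M borel ?\<Sigma>"
  have Zmeas: "Z i \<in> borel_measurable M" if "i \<in> {1..k}" for i
    using indep that by (auto simp: M.indep_vars_def)
  then have meas: "?\<Sigma> \<in> borel_measurable M" by (intro borel_measurable_sum)
  have rdS': "real_distribution S'" unfolding S'_def using meas by (rule M.real_distribution_distr)
  have "char S' t = char L t ^ k" for t
    unfolding S'_def using M.char_distr_sum[OF indep] Z by simp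
  moreover have "(\<lambda>j. char (S (\<sigma> j)) t) \<longlonglongrightarrow> char L t ^ k" for t
    unfolding S_def char_uniform_law_sum[OF finite_lessThan ne(1)]
    using tendsto_power[OF levy_continuity1[OF rdD L convD]] by (simp add: D_def)
  ultimately have convS: "weak_conv_m (\<lambda>j. S (\<sigma> j)) S'"
    using rdS rdS' by (intro levy_continuity) auto
  have "q_fun k x \<le> measure S' {1..}"
  proof (rule weak_conv_closed_le[OF rdS rdS' convS])
    show "(\<lambda>j. q_fun k (X (\<sigma> j)) - 1 / (real (\<sigma> j) + 1)) \<longlonglongrightarrow> q_fun k x"
      unfolding q_fun_def by (rule tendsto_eq_intros convX conv0 refl | simp)+
    fix j
    let ?n = "\<sigma> j"
    have "measure (S ?n) {1..} = card {p \<in> {..<k} \<rightarrow>\<^sub>E {..<m ?n}. 1 \<le> (\<Sum>i<k. w ?n (p i))} / real (m ?n) ^ k"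
      unfolding S_def using ne(2,3)[of ?n] by (subst measure_uniform_law) (auto simp: card_PiE)
    thus "q_fun k (X ?n) - 1 / (real ?n + 1) \<le> measure (S ?n) {1..}"
      using bad(3,7)[of ?n] by (simp add: pos_le_divide_eq)
  qed auto
  also have "measure S' {1..} = \<P>(\<omega> in M. ?\<Sigma> \<omega> \<ge> 1)"
    unfolding S'_def using meas by (subst measure_distr) (auto intro!: arg_cong[of _ _ "measure M"])
  finally have ge: "q_fun k x \<le> \<P>(\<omega> in M. ?\<Sigma> \<omega> \<ge> 1)" .
  have "tail_bound k x" using tb[of x] a x(1) by simp
  then have "\<P>(\<omega> in M. ?\<Sigma> \<omega> \<ge> 1) \<le> q_fun k x"
    and eq: "\<P>(\<omega> in M. ?\<Sigma> \<omega> \<ge> 1) = q_fun k x \<longleftrightarrow> (\<forall>i\<in>{1..k}. distr M borel (Z i) = two_point_law x)"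
    using iid unfolding tail_bound_def by blast+
  then have "\<forall>i\<in>{1..k}. distr M borel (Z i) = two_point_law x"
    using ge antisym[of _ "q_fun k x"] by blast
  then have "L = two_point_law x" using Z[of 1] k by auto
  then have "measure L {1 / k..} = x" using a u x(1) k by (simp add: measure_two_point_law)
  moreover have "x + \<eta> \<le> measure L {1 / k..}"
  proof (rule weak_conv_closed_le[OF rdD L convD])
    show "(\<lambda>j. X (\<sigma> j) + \<eta>) \<longlonglongrightarrow> x + \<eta>" using convX by (intro tendsto_intros)
    fix j
    let ?n = "\<sigma> j"
    have "measure (D ?n) {1 / k..} = card {b. b < m ?n \<and> 1 / k \<le> w ?n b} / real (m ?n)"
      unfolding D_def using ne(1)[of ?n] by (subst measure_uniform_law) auto
    thus "X ?n + \<eta> \<le> measure (D ?n) {1 / k..}"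
      using bad(3,8)[of ?n] by (simp add: pos_le_divide_eq less_imp_le)
  qed auto
  ultimately show False using \<eta> by simp
qed

section \<open>Almost extremal shifted families have a small cover\<close>

lemma fact_binomial_lower:
  assumes "k \<le> n" "0 < n"
  shows "real n ^ k - (real k)\<^sup>2 * real n ^ (k - 1) \<le> fact k * real (n choose k)"
proof (cases k)
  case (Suc j)
  have "real n ^ k - (real k)\<^sup>2 * real n ^ (k - 1) = real n ^ k * (1 + real k * (- (k / n)))"
    using assms Suc by (simp add: field_simps power2_eq_square)
  also have "\<dots> \<le> real n ^ k * (1 + - (k / n)) ^ k"
    using assms by (intro mult_left_mono Bernoulli_inequality) auto
  also have "\<dots> = (\<Prod>i = 0..<k. real n - real k)"
    using assms by (simp add: divide_simps mult.commute flip: power_mult_distrib)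
  also have "\<dots> \<le> (\<Prod>i = 0..<k. real n - real i)"
    using assms by (intro prod_mono) auto
  also have "\<dots> = fact k * real (n choose k)"
    by (simp add: binomial_gbinomial gbinomial_mult_fact)
  finally show ?thesis .
qed simp

text \<open>Up to lower order terms, the extremal family has the density \<open>q\<^sub>k (s / n)\<close> of the extremal law.\<close>

lemma fact_hitting_lower:
  assumes "k \<le> n" "0 < n" "s \<le> n"
  shows "real n ^ k * q_fun k (s / n) - (real k)\<^sup>2 * real n ^ (k - 1) \<le>
    fact k * (real (n choose k) - real (n - s choose k))"
proof -
  have "fact k * real (n - s choose k) = real ((n - s choose k) * fact k)" by simp
  also have "\<dots> \<le> real ((n - s) ^ k)" using binomial_fact_pow[of "n - s" k] by (simp only: of_nat_le_iff)
  also have "\<dots> = (real n * (1 - s / n)) ^ k"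
    using assms by (simp add: of_nat_diff right_diff_distrib)
  also have "\<dots> = real n ^ k * (1 - s / n) ^ k" by (simp add: power_mult_distrib)
  finally show ?thesis using fact_binomial_lower[OF assms(1,2)]
    by (simp add: q_fun_def right_diff_distrib)
qed

text \<open>The dual block weighting of an almost extremal family is an almost extremal law for the tail
  bound, so only about \<open>s / n\<close> of the blocks have weight at least \<open>1 / k\<close>. The parameters are chosen
  in the order \<open>\<epsilon>\<close>, number \<open>m\<close> of blocks, \<open>n\<close>.\<close>

lemma almost_cover:
  fixes f C \<eta> :: real
  assumes k: "0 < k" and f: "1 \<le> f" and C: "0 < C" and \<eta>: "0 < \<eta>"
    and tb: "\<And>x. 0 < x \<Longrightarrow> x \<le> 1 / f \<Longrightarrow> tail_bound k x"
  shows "\<exists>s0::nat. \<forall>n s F. s0 \<le> s \<and> 0 < s \<and> f * real s \<le> real n \<and> real n \<le> C * real s \<and>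
    F \<subseteq> nsets {1..n} k \<and> shifted F \<and> matching_at_most s F \<and> (n choose k) \<le> card F + (n - s choose k) \<longrightarrow>
    (\<exists>T\<subseteq>{1..n}. real (card T) \<le> s + \<eta> * n \<and> (\<forall>E\<in>F. E \<inter> T \<noteq> {}))"
proof -
  have "\<exists>\<epsilon>>0. \<forall>x m (w :: nat \<Rightarrow> real). 1 / C \<le> x \<and> x \<le> 1 / f \<and> 0 < m \<and> (\<forall>b. 0 \<le> w b \<and> w b \<le> 1) \<and>
      (\<Sum>b<m. w b) \<le> (x + \<epsilon>) * m \<and>
      (q_fun k x - \<epsilon>) * real m ^ k \<le> card {p \<in> {..<k} \<rightarrow>\<^sub>E {..<m}. 1 \<le> (\<Sum>i<k. w (p i))} \<longrightarrow>
      card {b. b < m \<and> 1 / k \<le> w b} \<le> (x + \<eta> / 3) * m"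
    using k f C \<eta> tb by (intro tail_bound_stability) auto
  then obtain \<epsilon> where \<epsilon>: "0 < \<epsilon>"
    and stab: "\<And>x m (w :: nat \<Rightarrow> real). 1 / C \<le> x \<Longrightarrow> x \<le> 1 / f \<Longrightarrow> 0 < m \<Longrightarrow> (\<forall>b. 0 \<le> w b \<and> w b \<le> 1) \<Longrightarrow>
      (\<Sum>b<m. w b) \<le> (x + \<epsilon>) * m \<Longrightarrow>
      (q_fun k x - \<epsilon>) * real m ^ k \<le> card {p \<in> {..<k} \<rightarrow>\<^sub>E {..<m}. 1 \<le> (\<Sum>i<k. w (p i))} \<Longrightarrow>
      card {b. b < m \<and> 1 / k \<le> w b} \<le> (x + \<eta> / 3) * m"
    by blast
  obtain m :: nat where m: "2 * fact k / \<epsilon> + 3 / \<eta> \<le> real m" using real_arch_simple by blast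
  have "0 < 2 * fact k / \<epsilon>" "0 < 3 / \<eta>" using \<epsilon> \<eta> by simp_all
  then have m1: "2 * fact k / \<epsilon> \<le> real m" and m2: "3 / \<eta> \<le> real m" and "0 < real m"
    using m by linarith+
  then have m0: "0 < m" by simp
  \<comment> \<open>The summands are the lower bounds on \<open>n\<close> needed below: nonempty blocks, \<open>k \<le> n\<close>, the mean of the
    weights, their tail probability, and the size of the cover.\<close>
  obtain s0 :: nat where s0: "real m + k + (real m ^ k + real m * (1 + \<epsilon>)) / \<epsilon> + 2 * ((real k)\<^sup>2 + fact k * real m) / \<epsilon> + 3 * real m / \<eta> \<le> real s0"
    using real_arch_simple by blast
  show ?thesis
  proof (intro exI[of _ s0] allI impI, elim conjE)
    fix n s F
    assume s: "s0 \<le> s" "0 < s" and n: "f * real s \<le> real n" "real n \<le> C * real s"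
      and F: "F \<subseteq> nsets {1..n} k" "shifted F" "matching_at_most s F"
      and large: "(n choose k) \<le> card F + (n - s choose k)"
    have "real s \<le> f * real s" using mult_right_mono[OF f, of "real s"] by simp
    then have sn: "s \<le> n" using n(1) by linarith
    have nn: "0 \<le> (real m ^ k + real m * (1 + \<epsilon>)) / \<epsilon>" "0 \<le> 2 * ((real k)\<^sup>2 + fact k * real m) / \<epsilon>" "0 \<le> 3 * real m / \<eta>"
      using \<epsilon> \<eta> by simp_all
    have "real m + k + (real m ^ k + real m * (1 + \<epsilon>)) / \<epsilon> + 2 * ((real k)\<^sup>2 + fact k * real m) / \<epsilon> + 3 * real m / \<eta> \<le> real n"
      using s0 s(1) sn by linarith
    then have big: "real m \<le> n" "real k \<le> n" "(real m ^ k + real m * (1 + \<epsilon>)) / \<epsilon> \<le> n"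
      "2 * ((real k)\<^sup>2 + fact k * real m) / \<epsilon> \<le> n" "3 * real m / \<eta> \<le> n"
      using nn by linarith+
    have n0: "0 < n" using sn s by simp
    define L where "L = n div m"
    have "m * L + n mod m = n" unfolding L_def by (rule mult_div_mod_eq)
    moreover have "n mod m < m" using m0 by simp
    moreover have "0 < L" using m0 big(1) by (simp add: L_def div_greater_zero_iff)
    ultimately have mL: "m * L \<le> n" "n < m * L + m" "0 < L" by linarith+
    have "real (m * L) \<le> real n" "real n \<le> real (m * L + m)" "real (n - m * L) \<le> real m"
      using mL by (simp_all only: of_nat_le_iff)
    then have Lr: "real m * L \<le> n" "real n \<le> real m * L + m" "real (n - m * L) \<le> m"
      by (simp_all only: of_nat_mult of_nat_add)
    then have Lm: "real L \<le> n / m" using m0 by (simp add: field_simps)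
    define x where "x = real s / n"
    have x: "1 / C \<le> x" "x \<le> 1 / f" "0 < x" "x \<le> 1" "x * n = s"
      using n n0 s f C sn by (auto simp: x_def field_simps)
    obtain w :: "nat \<Rightarrow> real" where w: "\<forall>b. 0 \<le> w b \<and> w b \<le> 1" "(\<Sum>b<m. w b) \<le> (real s + real m ^ k) / L"
      "\<And>p. p \<in> full_patterns k m L F \<Longrightarrow> 1 \<le> (\<Sum>i<k. w (p i))"
      using block_cover_exists[OF k mL(3) F(3), of m] by blast
    have mean: "(\<Sum>b<m. w b) \<le> (x + \<epsilon>) * m"
    proof -
      have "(real m ^ k + real m * (1 + \<epsilon>)) \<le> \<epsilon> * n" using big(3) \<epsilon> by (simp add: field_simps)
      moreover have "(x + \<epsilon>) * m \<le> (1 + \<epsilon>) * m" using x by (intro mult_right_mono) auto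
      ultimately have "real s + real m ^ k \<le> (x + \<epsilon>) * n - (x + \<epsilon>) * m" using x(5) by (simp add: algebra_simps)
      also have "\<dots> = (x + \<epsilon>) * (real n - m)" by (simp add: algebra_simps)
      also have "\<dots> \<le> (x + \<epsilon>) * (real m * L)" using x \<epsilon> Lr by (intro mult_left_mono) auto
      finally have "(real s + real m ^ k) / L \<le> (x + \<epsilon>) * m" using mL(3) by (simp add: field_simps)
      thus ?thesis using w(2) by linarith
    qed
    let ?R = "real (card (full_patterns k m L F))"
    have tail: "(q_fun k x - \<epsilon>) * real m ^ k \<le> card {p \<in> {..<k} \<rightarrow>\<^sub>E {..<m}. 1 \<le> (\<Sum>i<k. w (p i))}"
    proof -
      have pow: "real n ^ k = n * real n ^ (k - 1)" using k by (cases k) auto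
      have "(real k)\<^sup>2 + fact k * (real L + real (n - m * L)) \<le> \<epsilon> * n"
      proof -
        have "fact k * real L \<le> fact k * (n / m)" using Lm by (intro mult_left_mono) auto
        also have "\<dots> \<le> \<epsilon> * n / 2" using m1 m0 \<epsilon> n0 by (simp add: field_simps)
        finally have "fact k * real L \<le> \<epsilon> * n / 2" .
        moreover have "fact k * real (n - m * L) \<le> fact k * real m" using Lr by (intro mult_left_mono) auto
        moreover have "(real k)\<^sup>2 + fact k * real m \<le> \<epsilon> * n / 2" using big(4) \<epsilon> by (simp add: field_simps)
        ultimately show ?thesis unfolding distrib_left by linarith
      qed
      then have "((real k)\<^sup>2 + fact k * (real L + real (n - m * L))) * real n ^ (k - 1) \<le> \<epsilon> * n * real n ^ (k - 1)"
        by (rule mult_right_mono) simp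
      moreover have "real n ^ k * q_fun k x - (real k)\<^sup>2 * real n ^ (k - 1) \<le> fact k * (real (n choose k) - real (n - s choose k))"
        unfolding x_def using big(2) n0 sn by (intro fact_hitting_lower) auto
      moreover have "fact k * (real (n choose k) - real (n - s choose k)) \<le> fact k * real (card F)"
        using large by (intro mult_left_mono) auto
      moreover have "real (fact k * card F) \<le>
          real (card (full_patterns k m L F) * L ^ k + fact k * ((L + (n - m * L)) * n ^ (k - 1)))"
        using card_shifted_le[OF F(2,1) k mL(1)] by (simp only: of_nat_le_iff)
      then have "fact k * real (card F) \<le> ?R * real L ^ k + fact k * ((real L + real (n - m * L)) * real n ^ (k - 1))"
        by (simp only: of_nat_add of_nat_mult of_nat_power of_nat_fact)
      ultimately have "(q_fun k x - \<epsilon>) * real n ^ k \<le> ?R * real L ^ k"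
        unfolding pow by (simp only: algebra_simps)
      moreover have "(q_fun k x - \<epsilon>) * (real m * L) ^ k \<le> (q_fun k x - \<epsilon>) * real n ^ k" if "0 \<le> q_fun k x - \<epsilon>"
        using that Lr by (intro mult_left_mono power_mono) auto
      ultimately have "(q_fun k x - \<epsilon>) * real m ^ k * real L ^ k \<le> ?R * real L ^ k" if "0 \<le> q_fun k x - \<epsilon>"
        using that by (simp add: power_mult_distrib mult.assoc)
      then have "(q_fun k x - \<epsilon>) * real m ^ k \<le> ?R" if "0 \<le> q_fun k x - \<epsilon>"
        using that mL(3) by simp
      moreover have "(q_fun k x - \<epsilon>) * real m ^ k \<le> ?R" if "q_fun k x - \<epsilon> < 0"
        using that by (intro order_trans[OF mult_nonpos_nonneg]) auto
      ultimately have "(q_fun k x - \<epsilon>) * real m ^ k \<le> ?R" by linarith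
      also have "?R \<le> card {p \<in> {..<k} \<rightarrow>\<^sub>E {..<m}. 1 \<le> (\<Sum>i<k. w (p i))}"
        using w(3) by (intro of_nat_mono card_mono) (auto simp: full_patterns_def finite_PiE)
      finally show ?thesis .
    qed
    have heavy: "card {b. b < m \<and> 1 / k \<le> w b} \<le> (x + \<eta> / 3) * m"
      by (rule stab[OF x(1,2) m0 w(1) mean tail])
    obtain T where T: "T \<subseteq> {1..n}" "\<forall>E\<in>F. E \<inter> T \<noteq> {}"
      "card T \<le> L + (n - m * L) + L * card {b. b < m \<and> 1 / k \<le> w b}"
      using shifted_cover[where w = w, OF k F(2,1) mL(1) w(3)] by blast
    have "real (card T) \<le> real L + real (n - m * L) + L * real (card {b. b < m \<and> 1 / k \<le> w b})"
      using T(3) by (simp only: of_nat_le_iff flip: of_nat_add of_nat_mult)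
    also have "L * real (card {b. b < m \<and> 1 / k \<le> w b}) \<le> L * ((x + \<eta> / 3) * m)"
      using heavy by (intro mult_left_mono) auto
    also have "\<dots> = (x + \<eta> / 3) * (real m * L)" by simp
    also have "\<dots> \<le> (x + \<eta> / 3) * n" using Lr x \<eta> by (intro mult_left_mono) auto
    also have "real L \<le> \<eta> * n / 3"
    proof -
      have "n / m \<le> \<eta> * n / 3" using m2 m0 \<eta> n0 by (simp add: field_simps)
      thus ?thesis using Lm by linarith
    qed
    also have "real (n - m * L) \<le> \<eta> * n / 3" using Lr(3) big(5) \<eta> by (simp add: field_simps)
    finally have "real (card T) \<le> s + \<eta> * n" using x(5) by (simp add: algebra_simps)
    thus "\<exists>T\<subseteq>{1..n}. real (card T) \<le> s + \<eta> * n \<and> (\<forall>E\<in>F. E \<inter> T \<noteq> {})" using T by blast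
  qed
qed

section \<open>From a small cover to the exact bound\<close>

text \<open>Whichever of the first \<open>a\<close> vertices have been used already, a good vertex can be completed to an
  edge by any \<open>k - 1\<close> of the others.\<close>

definition good_vertices :: "nat \<Rightarrow> nat \<Rightarrow> nat \<Rightarrow> nat set set \<Rightarrow> nat set" where
  "good_vertices n k a F = {v \<in> {1..n}. \<forall>C\<in>nsets ({1..a} - {v}) (k - 1). insert v C \<in> F}"

text \<open>By shiftedness, one missing \<open>(k - 1)\<close>-set among the first \<open>a\<close> vertices forces all sets above
  \<open>a\<close> to be missing as well.\<close>

lemma not_good_missing:
  assumes "shifted F" "v \<in> {1..n}" "v \<notin> good_vertices n k a F" "D \<in> nsets ({a<..n} - {v}) (k - 1)"
  shows "insert v D \<notin> F"
proof
  assume in_F: "insert v D \<in> F"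
  obtain C where C: "C \<in> nsets ({1..a} - {v}) (k - 1)" "insert v C \<notin> F"
    using assms(2,3) by (auto simp: good_vertices_def)
  have CD: "C \<subseteq> {1..a} - {v}" "finite C" "D \<subseteq> {a<..n} - {v}" "finite D" "card D = card C"
    using C(1) assms(4) by (auto simp: nsets_def)
  then obtain g where g: "bij_betw g D C" using finite_same_card_bij by metis
  define \<phi> where "\<phi> x = (if x = v then v else g x)" for x
  have g_in: "g x \<in> C" if "x \<in> D" for x using g that by (auto simp: bij_betw_def)
  have \<phi>D: "\<phi> ` D = C"
  proof -
    have "\<phi> ` D = g ` D" using CD(3) by (intro image_cong) (auto simp: \<phi>_def)
    thus ?thesis using g by (simp add: bij_betw_def)
  qed
  have "\<phi> ` insert v D \<in> F"
  proof (rule shifted_decrease[OF assms(1) in_F])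
    have "inj_on \<phi> D"
    proof -
      have "inj_on \<phi> D \<longleftrightarrow> inj_on g D" using CD(3) by (intro inj_on_cong) (auto simp: \<phi>_def)
      thus ?thesis using g by (simp add: bij_betw_def)
    qed
    moreover have "\<phi> v \<notin> \<phi> ` (D - {v})" using CD(1) \<phi>D by (auto simp: \<phi>_def)
    ultimately show "inj_on \<phi> (insert v D)" by (simp add: inj_on_insert)
    fix x assume "x \<in> insert v D"
    then consider "x = v" | "x \<in> D" "x \<noteq> v" by auto
    thus "0 < \<phi> x \<and> \<phi> x \<le> x"
    proof cases
      case 1 thus ?thesis using assms(2) by (simp add: \<phi>_def)
    next
      case 2
      then have "g x \<in> {1..a}" "x \<in> {a<..n}" using g_in CD(1,3) by blast+
      then show ?thesis using 2(2) by (simp add: \<phi>_def)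
    qed
  qed (use CD in simp)
  moreover have "\<phi> v = v" by (simp add: \<phi>_def)
  ultimately have "insert v C \<in> F" using \<phi>D by simp
  thus False using C(2) by simp
qed

text \<open>The family hitting a cover \<open>T\<close> with \<open>|T| \<le> s + \<delta>\<close> is only slightly larger than \<open>F\<close>, while each
  element of \<open>T\<close> that is not good accounts for many missing edges.\<close>

lemma few_not_good:
  fixes \<delta> :: real
  assumes k: "0 < k" and sn: "s \<le> n" and F: "F \<subseteq> nsets {1..n} k" "shifted F"
    and large: "(n choose k) \<le> card F + (n - s choose k)"
    and T: "T \<subseteq> {1..n}" "card T \<le> s + \<delta>" "\<And>E. E \<in> F \<Longrightarrow> E \<inter> T \<noteq> {}" and \<delta>: "0 \<le> \<delta>"
  shows "real (s - card (good_vertices n k a F)) * (n - a - 1 choose (k - 1)) \<le> k * (\<delta> * n ^ (k - 1))"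
proof -
  let ?G = "good_vertices n k a F"
  have finT: "finite T" using T(1) finite_subset by blast
  have cT: "card T \<le> n" using card_mono[OF _ T(1)] by simp
  \<comment> \<open>A cover with fewer than \<open>s\<close> vertices is enlarged, so that its size is \<open>s + d\<close> with \<open>0 \<le> d \<le> \<delta>\<close>.\<close>
  have "s - card T \<le> card ({1..n} - T)"
    using sn finT T(1) by (simp add: card_Diff_subset diff_le_mono)
  then obtain U where U: "U \<subseteq> {1..n} - T" "card U = s - card T" "finite U"
    by (rule obtain_subset_with_card_n)
  define T' where "T' = T \<union> U"
  have T': "T' \<subseteq> {1..n}" "finite T'" "card T' = max s (card T)"
  proof -
    have "card T' = card T + card U"
      unfolding T'_def using U finT by (intro card_Un_disjoint) auto
    thus "card T' = max s (card T)" using U(2) by simp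
  qed (use T(1) U finT in \<open>auto simp: T'_def\<close>)
  define H where "H = hits {1..n} k T'"
  have finH: "finite H" by (simp add: H_def finite_hits)
  have FH: "F \<subseteq> H" using F(1) T(3) by (auto simp: H_def hits_def T'_def)
  define d where "d = card T' - s"
  have d: "card T' = s + d" "real d \<le> \<delta>" using T' T(2) \<delta> by (auto simp: d_def of_nat_diff max_def)
  have missing: "card (H - F) \<le> d * n ^ (k - 1)"
  proof -
    have sd: "s + d \<le> n" using d(1) card_mono[OF _ T'(1)] by simp
    have "card H + (n - (s + d) choose k) = (n choose k)"
      using card_hits[of "{1..n}" T' k] T' k d by (simp add: H_def)
    moreover have "card (H - F) + card F = card H"
      using FH finH by (metis card_Diff_subset card_mono finite_subset le_add_diff_inverse2)
    moreover have "n - (s + d) + d = n - s" using sd by simp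
    then have "(n - s choose k) \<le> (n - (s + d) choose k) + d * (n - s choose (k - 1))"
      using binomial_diff_bounds(1)[OF k, of "n - (s + d)" d] by simp
    moreover have "d * (n - s choose (k - 1)) \<le> d * n ^ (k - 1)"
      by (intro mult_left_mono order_trans[OF binomial_le_power] power_mono) auto
    ultimately show ?thesis using large by linarith
  qed
  \<comment> \<open>Count the missing edges \<open>insert v D\<close>; each of them comes from at most \<open>k\<close> pairs \<open>(v, D)\<close>.\<close>
  define B where "B = (SIGMA v:T' - ?G. nsets ({a<..n} - {v}) (k - 1))"
  define A where "A = (SIGMA E:H - F. E)"
  have finA: "finite A"
    using finH by (auto simp: A_def H_def hits_def nsets_def)
  have "card A = (\<Sum>E\<in>H - F. card E)"
    unfolding A_def using finH by (intro card_SigmaI) (auto simp: H_def hits_def nsets_def)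
  also have "\<dots> = card (H - F) * k" by (simp add: H_def hits_def nsets_def)
  finally have cA: "card A = card (H - F) * k" .
  let ?h = "\<lambda>(v, D). (insert v D, v)"
  have "inj_on ?h B"
    by (rule inj_onI) (auto simp: B_def nsets_def)
  moreover have "?h ` B \<subseteq> A"
  proof clarify
    fix v D assume vD: "(v, D) \<in> B"
    then have v: "v \<in> T'" "v \<notin> ?G" "v \<in> {1..n}" and D: "D \<in> nsets ({a<..n} - {v}) (k - 1)"
      using T' by (auto simp: B_def)
    have "insert v D \<in> nsets {1..n} k"
    proof -
      have "D \<subseteq> {a<..n} - {v}" "finite D" "card D = k - 1" using D by (auto simp: nsets_def)
      moreover from this have "v \<notin> D" by blast
      ultimately show ?thesis using v(3) k by (auto simp: nsets_def)
    qed
    then have "insert v D \<in> H" using v(1) by (auto simp: H_def hits_def)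
    moreover have "insert v D \<notin> F" using not_good_missing[OF F(2) v(3,2) D] .
    ultimately show "(insert v D, v) \<in> A" by (simp add: A_def)
  qed
  ultimately have BA: "card B \<le> card A" using finA by (rule card_inj_on_le)
  have "card (T' - ?G) * (n - a - 1 choose (k - 1)) \<le> (\<Sum>v\<in>T' - ?G. card (nsets ({a<..n} - {v}) (k - 1)))"
  proof -
    have "(n - a - 1 choose (k - 1)) \<le> card (nsets ({a<..n} - {v}) (k - 1))" for v
      by (simp add: binomial_right_mono diff_le_mono card_Diff_singleton_if)
    thus ?thesis using sum_bounded_below[of "T' - ?G" "n - a - 1 choose (k - 1)"] by simp
  qed
  also have "\<dots> = card B" unfolding B_def using T' by (intro card_SigmaI [symmetric]) (auto simp: finite_imp_finite_nsets)
  finally have "card (T' - ?G) * (n - a - 1 choose (k - 1)) \<le> card (H - F) * k" using BA cA by simp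
  moreover have "s - card ?G \<le> card (T' - ?G)"
  proof -
    have "finite ?G" by (simp add: good_vertices_def)
    then have "card T' - card ?G \<le> card (T' - ?G)" by (rule diff_card_le_card_Diff)
    thus ?thesis using T'(3) by linarith
  qed
  then have "(s - card ?G) * (n - a - 1 choose (k - 1)) \<le> card (T' - ?G) * (n - a - 1 choose (k - 1))"
    by (rule mult_le_mono1)
  ultimately have "(s - card ?G) * (n - a - 1 choose (k - 1)) \<le> (d * n ^ (k - 1)) * k"
    using mult_le_mono1[OF missing, of k] by linarith
  then have "real ((s - card ?G) * (n - a - 1 choose (k - 1))) \<le> real ((d * n ^ (k - 1)) * k)"
    by (simp only: of_nat_le_iff)
  also have "\<dots> = k * (real d * real n ^ (k - 1))" by simp
  also have "\<dots> \<le> k * (\<delta> * real n ^ (k - 1))"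
    using d(2) by (intro mult_left_mono mult_right_mono) auto
  finally show ?thesis by simp
qed

text \<open>Delete \<open>s - t\<close> good vertices. Since they can be used to extend any matching, the remaining
  family has matching number at most \<open>t\<close>, and its ground set is much larger than \<open>t\<close>.\<close>

lemma bound_from_good_vertices:
  assumes k: "2 \<le> k" and F: "F \<subseteq> nsets {1..n} k" "matching_at_most s F"
    and G: "G \<subseteq> good_vertices n k (k * (s + 1)) F" "card G \<le> s"
    and n: "k * (s + 1) \<le> n" "sparse_const k * (s - card G) \<le> n - s"
  shows "card F + (n - s choose k) \<le> (n choose k) \<and>
    (card F + (n - s choose k) = (n choose k) \<longrightarrow> (\<exists>S\<in>nsets {1..n} s. F = hits {1..n} k S))"
proof -
  define t where "t = s - card G"
  let ?V = "{1..n} - G"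
  define F' where "F' = {E \<in> F. E \<inter> G = {}}"
  define F1 where "F1 = {E \<in> F. E \<inter> G \<noteq> {}}"
  have Gn: "G \<subseteq> {1..n}" using G(1) by (auto simp: good_vertices_def)
  then have finG: "finite G" by (rule finite_subset) simp
  have "s + 1 \<le> k * (s + 1)" using k mult_le_mono1[of 1 k "s + 1"] by simp
  then have sn: "s \<le> n" using n(1) by linarith
  have cV: "card ?V = n - card G" using Gn finG by (simp add: card_Diff_subset)
  then have cVt: "card ?V - t = n - s" "n - s \<le> card ?V" using G(2) sn by (auto simp: t_def)
  have finF: "finite F" using F(1) finite_imp_finite_nsets[of "{1..n}"] finite_subset by blast
  have edge: "card E = k \<and> finite E" if "E \<in> F" for E using F(1) that by (auto simp: nsets_def)
  have "matching_at_most t F'"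
    unfolding matching_at_most_def
  proof (intro allI impI, rule ccontr)
    fix N assume N: "N \<subseteq> F'" "disjoint N" "\<not> card N \<le> t"
    then obtain N0 where N0: "N0 \<subseteq> N" "card N0 = t + 1" "finite N0"
      using obtain_subset_with_card_n[of "t + 1" N] by auto
    have sub: "N0 \<subseteq> F" using N0 N by (auto simp: F'_def)
    have dis: "disjoint N0" using N(2) N0(1) by (auto simp: disjoint_def)
    have cG: "card G + card N0 = s + 1" using N0(2) G(2) by (simp add: t_def)
    have "\<exists>N'\<subseteq>F. disjoint N' \<and> card N' = card G + card N0"
    proof (rule extend_matching[where A = "{1..k * (s + 1)}" and k = k, OF finG _ _ N0(3) sub dis edge])
      show "\<Union>N0 \<inter> G = {}" using N0 N by (auto simp: F'_def)
      show "insert v C \<in> F" if "v \<in> G" "C \<in> nsets ({1..k * (s + 1)} - {v}) (k - 1)" for v C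
        using that G(1) by (auto simp: good_vertices_def)
      show "k * (card G + card N0) \<le> card {1..k * (s + 1)}" unfolding cG by simp
    qed (use k in auto)
    then obtain N' where "N' \<subseteq> F" "disjoint N'" "card N' = s + 1" unfolding cG by blast
    thus False using matching_at_mostD[OF F(2), of N'] by simp
  qed
  moreover have "F' \<subseteq> nsets ?V k" using F(1) by (auto simp: F'_def nsets_def)
  moreover have "sparse_const k * t \<le> card ?V" using n(2) cVt by (simp add: t_def)
  ultimately have sparse: "card F' + (n - s choose k) \<le> (card ?V choose k)"
    and sparse_eq: "card F' + (n - s choose k) = (card ?V choose k) \<Longrightarrow> \<exists>S\<in>nsets ?V t. F' = hits ?V k S"
    using erdos_matching_sparse[of k ?V F' t] k cVt(1) by auto
  have split: "F = F' \<union> F1" "F' \<inter> F1 = {}" by (auto simp: F'_def F1_def)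
  then have cF: "card F = card F' + card F1" using finF by (metis card_Un_disjoint finite_Un)
  have finH: "finite (hits {1..n} k G)" by (simp add: finite_hits)
  have F1: "F1 \<subseteq> hits {1..n} k G" using F(1) by (auto simp: F1_def hits_def)
  have cH: "card (hits {1..n} k G) + (card ?V choose k) = (n choose k)"
    using card_hits[of "{1..n}" G k] Gn k cV by simp
  have cF1: "card F1 \<le> card (hits {1..n} k G)" by (rule card_mono[OF finH F1])
  have "\<exists>S\<in>nsets {1..n} s. F = hits {1..n} k S" if eq: "card F + (n - s choose k) = (n choose k)"
  proof -
    have "card F' + (n - s choose k) = (card ?V choose k)" "card F1 = card (hits {1..n} k G)"
      using eq cF cH cF1 sparse by linarith+
    then obtain S where S: "S \<in> nsets ?V t" "F' = hits ?V k S" and F1': "F1 = hits {1..n} k G"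
      using sparse_eq card_subset_eq[OF finH F1] by blast
    have "F = hits {1..n} k (G \<union> S)"
      unfolding split(1) S(2) F1' using S(1) by (auto simp: hits_def nsets_def)
    moreover have "G \<union> S \<in> nsets {1..n} s"
    proof -
      have "card (G \<union> S) = card G + card S" using S(1) finG by (intro card_Un_disjoint) (auto simp: nsets_def)
      thus ?thesis using S(1) Gn finG G(2) by (auto simp: nsets_def t_def)
    qed
    ultimately show ?thesis by blast
  qed
  thus ?thesis using cF cH cF1 sparse by linarith
qed

text \<open>When \<open>n\<close> exceeds a large multiple \<open>K\<close> of \<open>s\<close>, this is the sparse case. Otherwise \<open>s / n\<close> stays away
  from \<open>0\<close>, so an almost extremal family has a small cover, and all but \<open>\<gamma> n\<close> of the required \<open>s\<close> good
  vertices exist. Since \<open>f > k\<close>, a proportion \<open>c\<close> of the vertices lies beyond the first \<open>k (s + 1)\<close>.\<close>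

lemma erdos_matching_shifted:
  fixes f :: real
  assumes k: "2 \<le> k" and f: "real k < f"
    and tb: "\<And>x. 0 < x \<Longrightarrow> x \<le> 1 / f \<Longrightarrow> tail_bound k x"
  shows "\<exists>s0::nat. \<forall>n s F. s0 \<le> s \<and> 0 < s \<and> f * real s \<le> real n \<and> F \<subseteq> nsets {1..n} k \<and> shifted F \<and>
    matching_at_most s F \<longrightarrow> card F + (n - s choose k) \<le> (n choose k) \<and>
    (card F + (n - s choose k) = (n choose k) \<longrightarrow> (\<exists>S\<in>nsets {1..n} s. F = hits {1..n} k S))"
proof -
  define K where "K = sparse_const k"
  have K: "0 < K" using k by (simp add: K_def sparse_const_def)
  define c where "c = (1 - k / f) / 2"
  have c: "0 < c" using f k by (simp add: c_def)
  \<comment> \<open>With at most \<open>\<gamma> n\<close> good vertices missing, the sparse case applies to what remains because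
    \<open>n - s \<ge> n / 2\<close>; \<open>\<eta>\<close> is the size of the error in the cover that guarantees this.\<close>
  define \<gamma> where "\<gamma> = 1 / (2 * real K)"
  define \<eta> where "\<eta> = \<gamma> * (c / k) ^ (k - 1) / k"
  have \<eta>: "0 < \<eta>" using K c k by (simp add: \<eta>_def \<gamma>_def)
  have "\<exists>s0::nat. \<forall>n s F. s0 \<le> s \<and> 0 < s \<and> f * real s \<le> real n \<and> real n \<le> real K * real s \<and>
      F \<subseteq> nsets {1..n} k \<and> shifted F \<and> matching_at_most s F \<and> (n choose k) \<le> card F + (n - s choose k) \<longrightarrow>
      (\<exists>T\<subseteq>{1..n}. real (card T) \<le> s + \<eta> * n \<and> (\<forall>E\<in>F. E \<inter> T \<noteq> {}))"
    by (rule almost_cover) (use k f K \<eta> tb in auto)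
  then obtain s1 :: nat where s1: "\<forall>n s F. s1 \<le> s \<and> 0 < s \<and> f * real s \<le> real n \<and> real n \<le> real K * real s \<and>
      F \<subseteq> nsets {1..n} k \<and> shifted F \<and> matching_at_most s F \<and> (n choose k) \<le> card F + (n - s choose k) \<longrightarrow>
      (\<exists>T\<subseteq>{1..n}. real (card T) \<le> s + \<eta> * n \<and> (\<forall>E\<in>F. E \<inter> T \<noteq> {}))" ..
  obtain s2 :: nat where s2: "(k + 1) / c \<le> real s2" using real_arch_simple by blast
  show ?thesis
  proof (intro exI[of _ "max s1 s2"] allI impI, elim conjE)
    fix n s F
    assume s: "max s1 s2 \<le> s" "0 < s" and n: "f * real s \<le> real n"
      and F: "F \<subseteq> nsets {1..n} k" "shifted F" "matching_at_most s F"
    let ?goal = "card F + (n - s choose k) \<le> (n choose k) \<and>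
      (card F + (n - s choose k) = (n choose k) \<longrightarrow> (\<exists>S\<in>nsets {1..n} s. F = hits {1..n} k S))"
    have "2 * real s \<le> f * real s" using f k by (intro mult_right_mono) auto
    then have sn: "2 * s \<le> n" using n by linarith
    consider "K * s \<le> n" | "card F + (n - s choose k) < (n choose k)"
      | "n < K * s" "(n choose k) \<le> card F + (n - s choose k)" by linarith
    thus ?goal
    proof cases
      case 1
      thus ?thesis using erdos_matching_sparse[OF k _ F(1,3)] by (simp add: K_def)
    next
      case 2
      thus ?thesis by simp
    next
      case 3
      have "real n \<le> real (K * s)" using 3(1) by (simp only: of_nat_le_iff)
      then have nK: "real n \<le> real K * real s" by simp
      have "s1 \<le> s" using s(1) by simp
      then have "\<exists>T\<subseteq>{1..n}. real (card T) \<le> s + \<eta> * n \<and> (\<forall>E\<in>F. E \<inter> T \<noteq> {})"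
        using s(2) n nK F 3(2) by (intro s1[rule_format] conjI)
      then obtain T where T: "T \<subseteq> {1..n}" "real (card T) \<le> s + \<eta> * n" "\<forall>E\<in>F. E \<inter> T \<noteq> {}" by blast
      let ?a = "k * (s + 1)"
      let ?G = "good_vertices n k ?a F"
      have n0: "0 < real n" using sn s(2) by simp
      have "real s \<le> n / f" using n f k by (simp add: field_simps)
      then have "k * real s \<le> k * (n / f)" by (intro mult_left_mono) auto
      also have "\<dots> = n - 2 * (c * n)" by (simp add: c_def field_simps)
      finally have ks: "k * real s \<le> n - 2 * (c * n)" .
      have cn: "k + 1 \<le> c * n"
      proof -
        have "real s2 \<le> real n" using s(1) sn by linarith
        then have "(k + 1) / c \<le> n" using s2 by linarith
        thus ?thesis using c by (simp add: field_simps)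
      qed
      have room: "?a + 1 \<le> n" "c * n \<le> real (n - ?a - 1)"
      proof -
        have ra: "real (?a + 1) = k * real s + k + 1" by (simp add: algebra_simps)
        then have le: "real (?a + 1) \<le> real n - c * n" using ks cn by linarith
        moreover have "0 \<le> c * n" using c by simp
        ultimately have "real (?a + 1) \<le> real n" by linarith
        thus 1: "?a + 1 \<le> n" by (simp only: of_nat_le_iff)
        have "real (n - ?a - 1) = real n - real (?a + 1)" using 1 by (subst of_nat_diff[symmetric]) auto
        thus "c * n \<le> real (n - ?a - 1)" using le by linarith
      qed
      have "real (s - card ?G) * real (n - ?a - 1 choose (k - 1)) \<le> k * (\<eta> * n * real n ^ (k - 1))"
        using T 3(2) k sn \<eta> F by (intro few_not_good) auto
      moreover have "(c / k * n) ^ (k - 1) \<le> real (n - ?a - 1 choose (k - 1))"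
      proof -
        have "c / k * n = c * n / k" by simp
        also have "\<dots> \<le> real (n - ?a - 1) / k" using room(2) by (intro divide_right_mono) auto
        also have "\<dots> \<le> real (n - ?a - 1) / real (k - 1)" using k by (intro divide_left_mono) auto
        finally have "(c / k * n) ^ (k - 1) \<le> (real (n - ?a - 1) / real (k - 1)) ^ (k - 1)"
          using c by (intro power_mono) auto
        also have "\<dots> \<le> real (n - ?a - 1 choose (k - 1))"
        proof (rule binomial_ge_n_over_k_pow_k)
          have "real (k - 1) \<le> real (n - ?a - 1)" using room(2) cn by linarith
          thus "k - 1 \<le> n - ?a - 1" by (simp only: of_nat_le_iff)
        qed
        finally show ?thesis .
      qed
      then have "real (s - card ?G) * (c / k * n) ^ (k - 1) \<le> real (s - card ?G) * real (n - ?a - 1 choose (k - 1))"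
        by (rule mult_left_mono) simp
      ultimately have "real (s - card ?G) * (c / k * n) ^ (k - 1) \<le> k * (\<eta> * n * real n ^ (k - 1))" by linarith
      also have "k * (\<eta> * n * real n ^ (k - 1)) = \<gamma> * n * (c / k * n) ^ (k - 1)"
        unfolding \<eta>_def power_mult_distrib[of "c / k" "real n"] using k by simp
      finally have few: "real (s - card ?G) \<le> \<gamma> * n"
        using c k n0 by (subst (asm) mult_le_cancel_right) auto
      obtain G where G: "G \<subseteq> ?G" "card G = min s (card ?G)"
        using obtain_subset_with_card_n[of "min s (card ?G)" ?G] by auto
      have "s - card G = s - card ?G" using G(2) by simp
      then have "real (s - card G) \<le> \<gamma> * n" using few by (simp only:)
      then have "real K * real (s - card G) \<le> real K * (\<gamma> * n)" by (rule mult_left_mono) simp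
      also have "\<dots> = n / 2" using K by (simp add: \<gamma>_def)
      also have "\<dots> \<le> real (n - s)" using sn by (simp add: of_nat_diff)
      finally have "K * (s - card G) \<le> n - s" by (simp only: of_nat_le_iff flip: of_nat_mult)
      thus ?thesis using k F G room(1) unfolding K_def by (intro bound_from_good_vertices) auto
    qed
  qed
qed

section \<open>Reduction to shifted families\<close>

text \<open>Each shift that changes the family lowers the total weight, so shifting ends in a shifted family.
  The size and the matching bound are kept, and the characterization of equality is pulled back
  along every single shift.\<close>

lemma reduce_to_shifted:
  assumes k: "2 \<le> k" and n: "k * (s + 1) \<le> n" "s + 2 * k \<le> n"
    and shifted_case: "\<And>F. F \<subseteq> nsets {1..n} k \<Longrightarrow> shifted F \<Longrightarrow> matching_at_most s F \<Longrightarrow>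
      card F + c \<le> b \<and> (card F + c = b \<longrightarrow> (\<exists>S\<in>nsets {1..n} s. F = hits {1..n} k S))"
    and "F \<subseteq> nsets {1..n} k" "matching_at_most s F"
  shows "card F + c \<le> b \<and> (card F + c = b \<longrightarrow> (\<exists>S\<in>nsets {1..n} s. F = hits {1..n} k S))"
  using assms(5,6)
proof (induction "\<Sum>E\<in>F. \<Sum>E" arbitrary: F rule: less_induct)
  case less
  have finF: "finite F" using less.prems(1) finite_imp_finite_nsets[of "{1..n}"] finite_subset by blast
  have edge: "E \<subseteq> {1..n}" "finite E" if "E \<in> F" for E using less.prems(1) that by (auto simp: nsets_def)
  show ?case
  proof (cases "shifted F")
    case True
    thus ?thesis using shifted_case less.prems by blast
  next
    case False
    then obtain E j i where E: "E \<in> F" "j \<in> E" "0 < i" "i < j" "i \<notin> E" "insert i (E - {j}) \<notin> F"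
      unfolding shifted_def by blast
    have ij: "i \<in> {1..n}" "j \<in> {1..n}" "i \<noteq> j" using E edge[OF E(1)] by auto
    let ?m = "\<lambda>E. if moves i j F E then insert i (E - {j}) else E"
    have moved: "\<Sum>(insert i (A - {j})) < \<Sum>A" if "A \<in> F" "moves i j F A" for A
      using edge[OF that(1)] that(2) E(4) by (simp add: moves_def sum.remove[of A j])
    have "(\<Sum>A\<in>shift i j F. \<Sum>A) = (\<Sum>A\<in>F. \<Sum>(?m A))"
      unfolding shift_def by (subst sum.reindex[OF inj_on_shift]) simp
    also have "\<dots> < (\<Sum>A\<in>F. \<Sum>A)"
    proof (rule sum_strict_mono_ex1[OF finF])
      show "\<forall>A\<in>F. \<Sum>(?m A) \<le> \<Sum>A" using moved by (auto simp: less_imp_le)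
      show "\<exists>A\<in>F. \<Sum>(?m A) < \<Sum>A" using moved[OF E(1)] E by (intro bexI[of _ E]) (auto simp: moves_def)
    qed
    finally have IH: "card (shift i j F) + c \<le> b \<and> (card (shift i j F) + c = b \<longrightarrow>
        (\<exists>S\<in>nsets {1..n} s. shift i j F = hits {1..n} k S))"
      using less.hyps shift_nsets[OF less.prems(1) ij(1)] shift_matching[OF less.prems(2) finF] by blast
    show ?thesis
    proof (intro conjI impI)
      show "card F + c \<le> b" using IH by (simp add: card_shift)
      assume "card F + c = b"
      then obtain S where S: "S \<in> nsets {1..n} s" "shift i j F = hits {1..n} k S"
        using IH by (auto simp: card_shift)
      show "\<exists>S\<in>nsets {1..n} s. F = hits {1..n} k S"
        by (rule unshift_hits[OF k _ ij less.prems S]) (use n in auto)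
    qed
  qed
qed

theorem corollary5p3:
  fixes k :: nat and f :: real
  assumes "2 \<le> k"
    and "rho k \<le> f"
    and "\<forall>x. 0 < x \<and> x \<le> 1 / f \<longrightarrow> tail_bound k x"
  shows "\<exists>s0::nat. \<forall>(n::nat) (s::nat) F.
    0 < n \<and> 0 < s \<and> s0 \<le> s \<and> f * real s \<le> real n \<and>
    F \<subseteq> nsets {1..n} k \<and> matching_number F \<le> s \<longrightarrow>
      card F \<le> hitting_number k n s \<and>
      (card F = hitting_number k n s \<longleftrightarrow> (\<exists>S \<in> nsets {1..n} s. F = hitting_family k n S))"
proof -
  have "real k < rho k"
    using theI'[OF rho_ex1[OF assms(1)]] by (simp add: rho_def)
  then have f: "real k < f" using assms(2) by linarith
  have "\<exists>s0::nat. \<forall>n s F. s0 \<le> s \<and> 0 < s \<and> f * real s \<le> real n \<and> F \<subseteq> nsets {1..n} k \<and> shifted F \<and>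
    matching_at_most s F \<longrightarrow> card F + (n - s choose k) \<le> (n choose k) \<and>
    (card F + (n - s choose k) = (n choose k) \<longrightarrow> (\<exists>S\<in>nsets {1..n} s. F = hits {1..n} k S))"
    by (rule erdos_matching_shifted[OF assms(1) f]) (use assms(3) in auto)
  then obtain s1 :: nat where s1: "\<forall>n s F. s1 \<le> s \<and> 0 < s \<and> f * real s \<le> real n \<and> F \<subseteq> nsets {1..n} k \<and> shifted F \<and>
    matching_at_most s F \<longrightarrow> card F + (n - s choose k) \<le> (n choose k) \<and>
    (card F + (n - s choose k) = (n choose k) \<longrightarrow> (\<exists>S\<in>nsets {1..n} s. F = hits {1..n} k S))" ..
  obtain s2 :: nat where s2: "2 * k / (f - k) \<le> real s2" using real_arch_simple by blast
  show ?thesis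
  proof (intro exI[of _ "max s1 s2"] allI impI, elim conjE)
    fix n s F
    assume s: "0 < s" "max s1 s2 \<le> s" and n: "f * real s \<le> real n"
      and F: "F \<subseteq> nsets {1..n} k" "matching_number F \<le> s"
    have "finite F" using F(1) finite_imp_finite_nsets[of "{1..n}"] finite_subset by blast
    then have mF: "matching_at_most s F" using F(2) matching_at_most_iff by blast
    have "2 * k / (f - k) \<le> real s" using s2 s(2) by linarith
    then have "k * real s + 2 * k \<le> f * real s" using f by (simp add: field_simps)
    then have "real (k * s + 2 * k) \<le> real n" using n by simp
    then have big: "k * s + 2 * k \<le> n" by (simp only: of_nat_le_iff)
    have "s \<le> k * s" using assms(1) by simp
    then have big': "k * (s + 1) \<le> n" "s + 2 * k \<le> n" "s \<le> n"
      using big unfolding add_mult_distrib2 mult_1_right by linarith+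
    have main: "card F + (n - s choose k) \<le> (n choose k) \<and>
        (card F + (n - s choose k) = (n choose k) \<longrightarrow> (\<exists>S\<in>nsets {1..n} s. F = hits {1..n} k S))"
    proof (rule reduce_to_shifted[OF assms(1) big'(1,2) _ F(1) mF])
      fix F' assume "F' \<subseteq> nsets {1..n} k" "shifted F'" "matching_at_most s F'"
      moreover have "s1 \<le> s" using s(2) by simp
      ultimately show "card F' + (n - s choose k) \<le> (n choose k) \<and>
          (card F' + (n - s choose k) = (n choose k) \<longrightarrow> (\<exists>S\<in>nsets {1..n} s. F' = hits {1..n} k S))"
        using s(1) n by (intro s1[rule_format] conjI)
    qed
    have hit: "hitting_family k n S = hits {1..n} k S" for S by (simp add: hitting_family_def hits_def)
    have size: "hitting_number k n s + (n - s choose k) = (n choose k)"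
      unfolding hitting_number_def by (simp add: binomial_right_mono)
    have "card F = hitting_number k n s" if "S \<in> nsets {1..n} s" "F = hits {1..n} k S" for S
      using card_hits[of "{1..n}" S k] that assms(1) size by (simp add: nsets_def)
    thus "card F \<le> hitting_number k n s \<and>
        (card F = hitting_number k n s \<longleftrightarrow> (\<exists>S \<in> nsets {1..n} s. F = hitting_family k n S))"
      unfolding hit using main size by auto
  qed
qed

end
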